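(* Let $\mathbb{K}$ be a field, let $G$ be a finite simple graph with vertex set $V(G)=\{x_1,\ldots,x_n\}$, and let $S=\mathbb{K}[x_1,\ldots,x_n]$ be the polynomial ring whose variables are the vertices of $G$. Then $$\operatorname{depth} S/I(G)^{(2)}\geq \alpha_2(G)-1,$$ where $I(G)^{(2)}$ is the second symbolic power of the edge ideal $I(G)$ and $\alpha_2(G)$ is the star packing number of $G$.
   Context: The edge ideal of $G$ is $I(G)=(x_ix_j \mid x_ix_j\in E(G))\subseteq S$ (it is $0$ if $G$ has no edges). For an ideal $I$ of $S$ and an integer $s\ge 1$, the $s$-th symbolic power is $I^{(s)}=\bigcap_{\mathfrak{p}\in \mathrm{Min}(I)}\mathrm{Ker}(S\to (S/I^s)_{\mathfrak{p}})$, where $\mathrm{Min}(I)$ is the set of minimal primes of $I$. For edge ideals this equals $I(G)^{(s)}=\bigcap_{C\in\mathcal{C}(G)}\mathfrak{p}_C^s$, where $\mathcal{C}(G)$ is the set of minimal vertex covers of $G$ and $\mathfrak{p}_C$ is the prime ideal generated by the variables in $C$. For a vertex $x$, $N_G(x)$ is the set of vertices adjacent to $x$, and $N_G[x]=N_G(x)\cup\{x\}$. The star ${\rm St}(x)$ with center $x$ is the subgraph of $G$ with vertex set $N_G[x]$ and edge set $\{xy \mid y\in N_G(x)\}$. A star packing of $G$ is a family of stars in $G$ whose vertex sets are pairwise disjoint, and the star packing number $\alpha_2(G)$ is the largest cardinality of a star packing of $G$ (equivalently, the largest number of vertices of $G$ with pairwise disjoint closed neighborhoods $N_G[x]$). Depth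 is taken with respect to the graded maximal ideal $(x_1,\ldots,x_n)$. *)

theory Defs
  imports
    "HOL-Algebra.Algebraic_Closure_Type"
    "HOL-Algebra.Ideal_Product"
    "HOL-Algebra.QuotRing"
    "HOL-Algebra.Module"
    "HOL-Library.Poly_Mapping"
    "HOL-Library.Extended_Nat"
begin

section \<open>Commutative algebra\<close>

text \<open>The ring \<open>R / J\<close>, regarded as a module over \<open>R\<close>.\<close>

definition quot_module :: "('a, 'b) ring_scheme \<Rightarrow> 'a set \<Rightarrow> ('a, 'a set) module" where
  "quot_module R J =
     \<lparr> carrier = carrier (R Quot J), monoid.mult = monoid.mult (R Quot J), one = one (R Quot J),
       ring.zero = ring.zero (R Quot J), add = add (R Quot J),
       module.smult = (\<lambda>a c. (J +>\<^bsub>R\<^esub> a) \<otimes>\<^bsub>R Quot J\<^esub> c) \<rparr>"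

text \<open>The localization of an \<open>R\<close>-module \<open>M\<close> at a multiplicative set \<open>U\<close> is the set of equivalence
  classes \<open>frac R M U m s\<close> (that is, \<open>m / s\<close>) of pairs \<open>(m, s)\<close> with \<open>m\<close> in \<open>M\<close> and \<open>s\<close> in \<open>U\<close>.\<close>

definition frac_rel ::
  "('a, 'b) ring_scheme \<Rightarrow> ('a, 'c, 'd) module_scheme \<Rightarrow> 'a set \<Rightarrow> (('c \<times> 'a) \<times> ('c \<times> 'a)) set"
where
  "frac_rel R M U =
     {((m, s), (n, t)). m \<in> carrier M \<and> s \<in> U \<and> n \<in> carrier M \<and> t \<in> U \<and>
        (\<exists>u\<in>U. u \<odot>\<^bsub>M\<^esub> ((t \<odot>\<^bsub>M\<^esub> m) \<ominus>\<^bsub>M\<^esub> (s \<odot>\<^bsub>M\<^esub> n)) = \<zero>\<^bsub>M\<^esub>)}"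

definition frac ::
  "('a, 'b) ring_scheme \<Rightarrow> ('a, 'c, 'd) module_scheme \<Rightarrow> 'a set \<Rightarrow> 'c \<Rightarrow> 'a \<Rightarrow> ('c \<times> 'a) set"
where
  "frac R M U m s = frac_rel R M U `` {(m, s)}"

text \<open>The kernel of the canonical map from \<open>R\<close> to the localization of \<open>R / J\<close> at the prime \<open>p\<close>.\<close>

definition loc_kernel :: "('a, 'b) ring_scheme \<Rightarrow> 'a set \<Rightarrow> 'a set \<Rightarrow> 'a set" where
  "loc_kernel R J p =
     {f \<in> carrier R.
        frac R (quot_module R J) (carrier R - p) (J +>\<^bsub>R\<^esub> f) \<one>\<^bsub>R\<^esub> =
        frac R (quot_module R J) (carrier R - p) \<zero>\<^bsub>quot_module R J\<^esub> \<one>\<^bsub>R\<^esub>}"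

definition minimal_primes :: "('a, 'b) ring_scheme \<Rightarrow> 'a set \<Rightarrow> 'a set set" where
  "minimal_primes R I =
     {p. primeideal p R \<and> I \<subseteq> p \<and> (\<forall>q. primeideal q R \<and> I \<subseteq> q \<and> q \<subseteq> p \<longrightarrow> q = p)}"

text \<open>The \<open>s\<close>-th ordinary power of \<open>I\<close> is taken in the monoid of ideals of \<open>R\<close> under the ideal
  product.\<close>

definition symbolic_power :: "('a, 'b) ring_scheme \<Rightarrow> 'a set \<Rightarrow> nat \<Rightarrow> 'a set" where
  "symbolic_power R I s =
     carrier R \<inter> (\<Inter>p \<in> minimal_primes R I. loc_kernel R (I [^]\<^bsub>ideals_set R\<^esub> s) p)"

text \<open>The submodule \<open>(f\<^sub>1, \<dots>, f\<^sub>r) M\<close>; it is zero for the empty list.\<close>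

definition seq_submodule ::
  "('a, 'b) ring_scheme \<Rightarrow> ('a, 'c, 'd) module_scheme \<Rightarrow> 'a list \<Rightarrow> 'c set"
where
  "seq_submodule R M fs =
     {finsum M (\<lambda>i. (fs ! i) \<odot>\<^bsub>M\<^esub> g i) {..<length fs} | g. g \<in> {..<length fs} \<rightarrow> carrier M}"

text \<open>Each \<open>f\<^sub>i\<close> is a non-zero-divisor on \<open>M / (f\<^sub>1, \<dots>, f\<^sub>i\<^sub>-\<^sub>1) M\<close>, expressed on representatives, and
  \<open>M / (f\<^sub>1, \<dots>, f\<^sub>r) M\<close> is nonzero.\<close>

definition regular_sequence ::
  "('a, 'b) ring_scheme \<Rightarrow> ('a, 'c, 'd) module_scheme \<Rightarrow> 'a list \<Rightarrow> bool"
where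
  "regular_sequence R M fs \<longleftrightarrow>
     set fs \<subseteq> carrier R \<and>
     (\<forall>i < length fs. \<forall>m \<in> carrier M.
        (fs ! i) \<odot>\<^bsub>M\<^esub> m \<in> seq_submodule R M (take i fs) \<longrightarrow> m \<in> seq_submodule R M (take i fs)) \<and>
     seq_submodule R M fs \<noteq> carrier M"

text \<open>The depth of \<open>M\<close> with respect to \<open>\<aa>\<close> is the supremum of the lengths of the \<open>M\<close>-regular
  sequences in \<open>\<aa>\<close>. It is only meant for \<open>M \<noteq> \<aa> M\<close>
  (otherwise the usual convention is \<open>\<infinity>\<close>).\<close>

definition depth ::
  "('a, 'b) ring_scheme \<Rightarrow> 'a set \<Rightarrow> ('a, 'c, 'd) module_scheme \<Rightarrow> enat"
where
  "depth R \<aa> M = Sup {enat (length fs) | fs. regular_sequence R M fs \<and> set fs \<subseteq> \<aa>}"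


section \<open>The polynomial ring on the vertices\<close>

text \<open>A monomial is its exponent vector \<open>'v \<Rightarrow>\<^sub>0 nat\<close>, and a polynomial is a finitely supported
  family of coefficients indexed by monomials; multiplication is convolution.\<close>

type_synonym ('v, 'k) mpoly = "('v \<Rightarrow>\<^sub>0 nat) \<Rightarrow>\<^sub>0 'k"

abbreviation mpoly_ring :: "('v, 'k::field) mpoly ring" where
  "mpoly_ring \<equiv> ring_of_type_algebra"

definition Var :: "'v \<Rightarrow> ('v, 'k::field) mpoly" where
  "Var v = Poly_Mapping.single (Poly_Mapping.single v 1) 1"

definition graded_max_ideal :: "('v, 'k::field) mpoly set" where
  "graded_max_ideal = Idl\<^bsub>mpoly_ring\<^esub> (Var ` UNIV)"


section \<open>Graphs\<close>

text \<open>A simple graph whose vertex set is the whole type \<open>'v\<close> is given by its set of edges.\<close>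

definition simple_graph :: "'v set set \<Rightarrow> bool" where
  "simple_graph E \<longleftrightarrow> (\<forall>e \<in> E. card e = 2)"

definition edge_ideal :: "'v set set \<Rightarrow> ('v, 'k::field) mpoly set" where
  "edge_ideal E = Idl\<^bsub>mpoly_ring\<^esub> {Var x * Var y | x y. {x, y} \<in> E}"

definition nbhd :: "'v set set \<Rightarrow> 'v \<Rightarrow> 'v set" where
  "nbhd E x = {y. {x, y} \<in> E}"

definition closed_nbhd :: "'v set set \<Rightarrow> 'v \<Rightarrow> 'v set" where
  "closed_nbhd E x = insert x (nbhd E x)"

text \<open>A star is a subgraph, recorded as the pair of its vertex set and its edge set.\<close>

definition star :: "'v set set \<Rightarrow> 'v \<Rightarrow> 'v set \<times> 'v set set" where
  "star E x = (closed_nbhd E x, {{x, y} | y. y \<in> nbhd E x})"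

definition star_packing :: "'v set set \<Rightarrow> ('v set \<times> 'v set set) set \<Rightarrow> bool" where
  "star_packing E P \<longleftrightarrow> P \<subseteq> star E ` UNIV \<and> pairwise (\<lambda>A B. disjnt (fst A) (fst B)) P"

definition star_packing_number :: "'v::finite set set \<Rightarrow> nat" where
  "star_packing_number E = Max (card ` {P. star_packing E P})"

end

theory Submission
  imports Defs
begin

text \<open>Let \<open>A\<^sub>0, \<dots>, A\<^sub>r\<close> be the vertex sets of the stars of a maximal packing and \<open>f\<^sub>i\<close> the sum of
  the variables in \<open>A\<^sub>i\<close>. The differences \<open>f\<^sub>i - f\<^sub>r\<close> for \<open>i < r\<close> form a regular sequence on
  \<open>S/I(G)\<^sup>(\<^sup>2\<^sup>)\<close>. A sequence that is regular on \<open>S/(J : m)\<close> and on \<open>S/(J, m)\<close> is regular on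
  \<open>S/J\<close>. Adding the edges to the monomial ideal \<open>I(G)\<^sup>(\<^sup>2\<^sup>)\<close> one after the other therefore reduces
  the claim to \<open>I(G)\<close> and to the colon ideals by an edge \<open>xy\<close>; each of these is the edge ideal of the
  graph obtained from \<open>G\<close> by joining \<open>N(x)\<close> with \<open>N(y)\<close>, together with some variables. Repeating
  the same reduction with single variables leads to quotients \<open>S/(W)\<close> by a set \<open>W\<close> of variables, and
  the variables used can be chosen so that \<open>W\<close> contains at most one of the \<open>A\<^sub>i\<close>. Then the
  \<open>f\<^sub>i - f\<^sub>r\<close> are linearly independent linear forms modulo \<open>W\<close>, hence a regular sequence.\<close>

section \<open>Regular sequences and filtrations\<close>

text \<open>The filtration passes on the regularity of one fixed sequence, so the same linear forms
  must survive in every quotient that the reductions produce. They cannot be chosen branch by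
  branch, although the star that gets lost does depend on the branch; hence the differences, which
  tolerate the loss of any single A_i. The choice of variables keeps an invariant: A_i has a
  \<open>centre\<close>, a vertex not yet deleted whose remaining neighbours all lie in A_i. It need
  not be the original centre of the star, and the colon by a variable of A_i moves it to that
  variable. The obstacle is the colon by an edge xy. The joining can spoil both the star whose
  centre is adjacent to x and the one whose centre is adjacent to y, one more than may be lost. The
  completeness of the join repairs this: x and y lie in these two sets and serve as reserve centres,
  at least one of which can be saved in every branch.\<close>

definition is_ideal :: "'a::comm_ring_1 set \<Rightarrow> bool" where
  "is_ideal J \<longleftrightarrow> 0 \<in> J \<and> (\<forall>a\<in>J. \<forall>b\<in>J. a + b \<in> J) \<and> (\<forall>a\<in>J. \<forall>r. r * a \<in> J)"

definition extend :: "'a::comm_ring_1 set \<Rightarrow> 'a \<Rightarrow> 'a set" where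
  "extend J g = {j + g * h | j h. j \<in> J}"

definition colon :: "'a::comm_ring_1 set \<Rightarrow> 'a \<Rightarrow> 'a set" where
  "colon J m = {h. m * h \<in> J}"

text \<open>Weak regularity: the condition that the last quotient be nonzero is left out, so that
  the filtration only has to transport non-zero-divisors. Properness is checked once, for the whole
  sequence, at the end.\<close>

fun wreg :: "'a::comm_ring_1 set \<Rightarrow> 'a list \<Rightarrow> bool" where
  "wreg J [] \<longleftrightarrow> True"
| "wreg J (g # gs) \<longleftrightarrow> (\<forall>f. g * f \<in> J \<longrightarrow> f \<in> J) \<and> wreg (extend J g) gs"

lemma is_idealI:
  assumes "0 \<in> J" "\<And>a b. a \<in> J \<Longrightarrow> b \<in> J \<Longrightarrow> a + b \<in> J" "\<And>a r. a \<in> J \<Longrightarrow> r * a \<in> J"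
  shows "is_ideal J"
  using assms by (auto simp: is_ideal_def)

lemma
  assumes "is_ideal J"
  shows is_ideal_zero: "0 \<in> J"
    and is_ideal_add: "a \<in> J \<Longrightarrow> b \<in> J \<Longrightarrow> a + b \<in> J"
    and is_ideal_mult: "a \<in> J \<Longrightarrow> r * a \<in> J"
    and is_ideal_mult_right: "a \<in> J \<Longrightarrow> a * r \<in> J"
    and is_ideal_uminus: "a \<in> J \<Longrightarrow> - a \<in> J"
    and is_ideal_diff: "a \<in> J \<Longrightarrow> b \<in> J \<Longrightarrow> a - b \<in> J"
proof -
  show z: "0 \<in> J" and a: "\<And>a b. a \<in> J \<Longrightarrow> b \<in> J \<Longrightarrow> a + b \<in> J"
    and m: "\<And>a r. a \<in> J \<Longrightarrow> r * a \<in> J"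
    using assms by (auto simp: is_ideal_def)
  show "a \<in> J \<Longrightarrow> a * r \<in> J" for a r using m[of a r] by (simp add: mult.commute)
  show u: "a \<in> J \<Longrightarrow> - a \<in> J" for a using m[of a "-1"] by simp
  show "a \<in> J \<Longrightarrow> b \<in> J \<Longrightarrow> a - b \<in> J" for a b using a[of a "-b"] u[of b] by simp
qed

lemma is_ideal_sum:
  assumes "is_ideal J" "\<And>i. i \<in> A \<Longrightarrow> f i \<in> J"
  shows "sum f A \<in> J"
  using assms(2)
  by (induction A rule: infinite_finite_induct)
     (auto intro: is_ideal_zero[OF assms(1)] is_ideal_add[OF assms(1)])

lemma is_ideal_cong:
  assumes "is_ideal J" "a - b \<in> J" shows "a \<in> J \<longleftrightarrow> b \<in> J"
  using is_ideal_diff[OF assms(1), of a "a - b"] is_ideal_add[OF assms(1), of b "a - b"] assms(2)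
  by auto

lemma extendI: "j \<in> J \<Longrightarrow> f = j + g * h \<Longrightarrow> f \<in> extend J g"
  by (auto simp: extend_def)

lemma extendE:
  assumes "f \<in> extend J g" obtains j h where "f = j + g * h" "j \<in> J"
  using assms by (auto simp: extend_def)

lemma is_ideal_extend: assumes "is_ideal J" shows "is_ideal (extend J g)"
proof (rule is_idealI)
  show "0 \<in> extend J g"
    by (rule extendI[of 0 _ _ _ 0]) (auto intro: is_ideal_zero[OF assms])
next
  fix a b assume "a \<in> extend J g" "b \<in> extend J g"
  then obtain j h j' h' where "a = j + g * h" "b = j' + g * h'" "j \<in> J" "j' \<in> J"
    by (auto elim!: extendE)
  then show "a + b \<in> extend J g"
    by (intro extendI[of "j + j'" _ _ _ "h + h'"] is_ideal_add[OF assms])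
       (auto simp: algebra_simps)
next
  fix a r assume "a \<in> extend J g"
  then obtain j h where "a = j + g * h" "j \<in> J" by (auto elim!: extendE)
  then show "r * a \<in> extend J g"
    by (intro extendI[of "r * j" _ _ _ "r * h"] is_ideal_mult[OF assms])
       (auto simp: algebra_simps)
qed

lemma extend_commute: "extend (extend J g) m = extend (extend J m) g"
proof -
  have "extend (extend J g) m \<subseteq> extend (extend J m) g" for g m :: 'a
  proof
    fix f assume "f \<in> extend (extend J g) m"
    then obtain j h h' where f: "f = j + g * h + m * h'" "j \<in> J" by (auto elim!: extendE)
    then have "f = (j + m * h') + g * h" by (simp add: algebra_simps)
    with f(2) show "f \<in> extend (extend J m) g" by (blast intro: extendI)
  qed
  then show ?thesis by blast
qed

lemma subset_extend: "J \<subseteq> extend J g"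
  by (auto intro!: extendI[of _ _ _ _ 0])

text \<open>If g is a non-zero-divisor on S/(J, m), the exact sequence of J : m, J and (J, m) stays
  exact modulo g. In m h = j + g a the hypothesis puts a into (J, m), say a = j' + m b, and then m
  (h - g b) lies in J.\<close>

lemma colon_extend:
  assumes J: "is_ideal J" and g: "\<And>f. g * f \<in> extend J m \<Longrightarrow> f \<in> extend J m"
  shows "colon (extend J g) m = extend (colon J m) g"
proof safe
  fix h assume "h \<in> colon (extend J g) m"
  then obtain j a where e: "m * h = j + g * a" "j \<in> J" by (auto simp: colon_def extend_def)
  have "g * a = (-j) + m * h" using e by simp
  then have "g * a \<in> extend J m" using is_ideal_uminus[OF J e(2)] unfolding extend_def by blast
  then obtain j' b where a: "a = j' + m * b" "j' \<in> J" using g[of a] by (auto simp: extend_def)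
  have "m * (h - g * b) = j + g * j'" using e a by (simp add: algebra_simps)
  then have "h - g * b \<in> colon J m"
    using e(2) a(2) by (auto simp: colon_def intro!: is_ideal_add[OF J] is_ideal_mult[OF J])
  then have "h - g * b + g * b \<in> extend (colon J m) g" unfolding extend_def by blast
  then show "h \<in> extend (colon J m) g" by simp
next
  fix h assume "h \<in> extend (colon J m) g"
  then obtain j b where "h = j + g * b" "m * j \<in> J" by (auto simp: extend_def colon_def)
  then show "h \<in> colon (extend J g) m"
    unfolding colon_def by (auto simp: algebra_simps intro!: extendI[of "m * j" _ _ _ "m * b"])
qed

text \<open>The element version of the short exact sequence
  \<open>0 \<rightarrow> S/(J : m) \<rightarrow> S/J \<rightarrow> S/(J, m) \<rightarrow> 0\<close>.\<close>

lemma wreg_filtration: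
  assumes "is_ideal J" "wreg (colon J m) gs" "wreg (extend J m) gs"
  shows "wreg J gs"
  using assms
proof (induction gs arbitrary: J)
  case (Cons g gs)
  note J = Cons.prems(1)
  have r1: "\<And>f. g * f \<in> colon J m \<Longrightarrow> f \<in> colon J m" and w1: "wreg (extend (colon J m) g) gs"
   and r2: "\<And>f. g * f \<in> extend J m \<Longrightarrow> f \<in> extend J m" and w2: "wreg (extend (extend J m) g) gs"
    using Cons.prems by auto
  have "f \<in> J" if gf: "g * f \<in> J" for f
  proof -
    obtain j h where f: "f = j + m * h" "j \<in> J"
      using r2[of f] gf subset_extend[of J m] by (blast elim: extendE)
    have "m * (g * h) = g * f - g * j" using f by (simp add: algebra_simps)
    then have "m * (g * h) \<in> J" using is_ideal_diff[OF J gf is_ideal_mult[OF J f(2)]] by simp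
    then have "m * h \<in> J" using r1[of h] by (simp add: colon_def)
    with f show ?thesis using is_ideal_add[OF J] by blast
  qed
  moreover have "wreg (extend J g) gs"
  proof (rule Cons.IH[OF is_ideal_extend[OF J]])
    show "wreg (colon (extend J g) m) gs" using w1 colon_extend[OF J r2] by simp
    show "wreg (extend (extend J g) m) gs" using w2 by (simp add: extend_commute[of J g m])
  qed
  ultimately show ?case by simp
qed simp

text \<open>Turns the iterated sums of ideals into explicit combinations, the form in which
  \<open>seq_submodule\<close> is defined.\<close>

lemma foldl_extend_iff:
  "f \<in> foldl extend J gs \<longleftrightarrow> (\<exists>h. f - (\<Sum>i<length gs. gs ! i * h i) \<in> J)"
proof (induction gs arbitrary: f rule: rev_induct)
  case Nil then show ?case by simp
next
  case (snoc g gs)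
  have *: "(\<Sum>i<length (gs @ [g]). (gs @ [g]) ! i * h i)
      = (\<Sum>i<length gs. gs ! i * h i) + g * h (length gs)" for h :: "nat \<Rightarrow> 'a"
    by (simp add: nth_append)
  show ?case
  proof
    assume "f \<in> foldl extend J (gs @ [g])"
    then obtain j a where f: "f = j + g * a" "j \<in> foldl extend J gs" by (auto simp: extend_def)
    then obtain h where h: "j - (\<Sum>i<length gs. gs ! i * h i) \<in> J" using snoc by auto
    have "(\<Sum>i<length gs. gs ! i * (h(length gs := a)) i) = (\<Sum>i<length gs. gs ! i * h i)"
      by (rule sum.cong) auto
    then have "f - (\<Sum>i<length (gs @ [g]). (gs @ [g]) ! i * (h(length gs := a)) i) \<in> J"
      unfolding * using f(1) h by simp
    then show "\<exists>h. f - (\<Sum>i<length (gs @ [g]). (gs @ [g]) ! i * h i) \<in> J" by blast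
  next
    assume "\<exists>h. f - (\<Sum>i<length (gs @ [g]). (gs @ [g]) ! i * h i) \<in> J"
    then obtain h where "f - ((\<Sum>i<length gs. gs ! i * h i) + g * h (length gs)) \<in> J"
      unfolding * by blast
    then have "f - g * h (length gs) \<in> foldl extend J gs"
      unfolding snoc by (auto simp: algebra_simps)
    then have "f - g * h (length gs) + g * h (length gs) \<in> extend (foldl extend J gs) g"
      unfolding extend_def by blast
    then show "f \<in> foldl extend J (gs @ [g])" by simp
  qed
qed

lemma wreg_nthD:
  assumes "wreg J gs" "i < length gs" "gs ! i * f \<in> foldl extend J (take i gs)"
  shows "f \<in> foldl extend J (take i gs)"
  using assms
proof (induction gs arbitrary: J i)
  case (Cons g gs)
  then show ?case by (cases i) auto
qed simp

section \<open>Quotients of a ring given by a type\<close>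

lemma ring_of_type_algebra_simps [simp]:
  "carrier ring_of_type_algebra = UNIV"
  "x \<otimes>\<^bsub>ring_of_type_algebra\<^esub> y = x * y"
  "x \<oplus>\<^bsub>ring_of_type_algebra\<^esub> y = x + y"
  "\<one>\<^bsub>ring_of_type_algebra\<^esub> = 1"
  "\<zero>\<^bsub>ring_of_type_algebra\<^esub> = 0"
  by (simp_all add: ring_of_type_algebra_def)

lemma ideal_iff_is_ideal: "ideal J (ring_of_type_algebra :: 'a::comm_ring_1 ring) \<longleftrightarrow> is_ideal J"
proof
  assume "ideal J (ring_of_type_algebra :: 'a ring)"
  then interpret ideal J "ring_of_type_algebra :: 'a ring" .
  show "is_ideal J"
  proof (rule is_idealI)
    show "0 \<in> J" using additive_subgroup.zero_closed[OF additive_subgroup_axioms] by simp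
    show "a + b \<in> J" if "a \<in> J" "b \<in> J" for a b using additive_subgroup.a_closed[OF additive_subgroup_axioms that] by simp
    show "r * a \<in> J" if "a \<in> J" for a r using I_l_closed[OF that, of r] by simp
  qed
next
  assume J: "is_ideal J"
  interpret cring "ring_of_type_algebra :: 'a ring" by (rule cring_from_type_algebra)
  have inv: "\<ominus>\<^bsub>ring_of_type_algebra\<^esub> x = - x" for x :: 'a
    by (rule minus_equality) simp_all
  show "ideal J (ring_of_type_algebra :: 'a ring)"
  proof (rule idealI)
    show "subgroup J (add_monoid (ring_of_type_algebra :: 'a ring))"
    proof
      show "inv\<^bsub>add_monoid ring_of_type_algebra\<^esub> x \<in> J" if "x \<in> J" for x
        unfolding inv[unfolded a_inv_def] using that by (rule is_ideal_uminus[OF J])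
    qed (auto intro: is_ideal_zero[OF J] is_ideal_add[OF J])
  qed (auto intro: ring_axioms is_ideal_mult[OF J] is_ideal_mult_right[OF J])
qed

lemma a_r_coset_type: "J +>\<^bsub>ring_of_type_algebra\<^esub> a = (\<lambda>j. j + a) ` J" for a :: "'a::comm_ring_1"
  by (auto simp: a_r_coset_def' )

lemma coset_eq_iff:
  fixes a b :: "'a::comm_ring_1"
  assumes J: "is_ideal J"
  shows "J +>\<^bsub>ring_of_type_algebra\<^esub> a = J +>\<^bsub>ring_of_type_algebra\<^esub> b \<longleftrightarrow> a - b \<in> J"
proof
  assume "J +>\<^bsub>ring_of_type_algebra\<^esub> a = J +>\<^bsub>ring_of_type_algebra\<^esub> b"
  then have "a \<in> (\<lambda>j. j + b) ` J"
    using is_ideal_zero[OF J] by (force simp: a_r_coset_type image_iff)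
  then show "a - b \<in> J" by auto
next
  have *: "(\<lambda>j. j + a) ` J \<subseteq> (\<lambda>j. j + b) ` J" if "a - b \<in> J" for a b
  proof safe
    fix j assume "j \<in> J"
    then have "j + (a - b) \<in> J" using that is_ideal_add[OF J] by blast
    then show "j + a \<in> (\<lambda>j. j + b) ` J" by (rule rev_image_eqI) simp
  qed
  assume "a - b \<in> J"
  then show "J +>\<^bsub>ring_of_type_algebra\<^esub> a = J +>\<^bsub>ring_of_type_algebra\<^esub> b"
    using *[of a b] *[of b a] is_ideal_uminus[OF J, of "a - b"] by (auto simp: a_r_coset_type)
qed

lemma carrier_quot_module:
  "carrier (quot_module ring_of_type_algebra J) = range (\<lambda>a. J +>\<^bsub>ring_of_type_algebra\<^esub> a)"
  for J :: "'a::comm_ring_1 set"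
  unfolding quot_module_def FactRing_def A_RCOSETS_def' by auto

lemma quot_module_ops:
  fixes a b :: "'a::comm_ring_1"
  assumes "is_ideal J"
  shows "(J +>\<^bsub>ring_of_type_algebra\<^esub> a) \<oplus>\<^bsub>quot_module ring_of_type_algebra J\<^esub> (J +>\<^bsub>ring_of_type_algebra\<^esub> b)
         = J +>\<^bsub>ring_of_type_algebra\<^esub> (a + b)"
    and "a \<odot>\<^bsub>quot_module ring_of_type_algebra J\<^esub> (J +>\<^bsub>ring_of_type_algebra\<^esub> b)
         = J +>\<^bsub>ring_of_type_algebra\<^esub> (a * b)"
    and "\<zero>\<^bsub>quot_module ring_of_type_algebra J\<^esub> = J +>\<^bsub>ring_of_type_algebra\<^esub> 0"
proof -
  interpret ideal J "ring_of_type_algebra :: 'a ring" using assms by (simp add: ideal_iff_is_ideal)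
  show "(J +>\<^bsub>ring_of_type_algebra\<^esub> a) \<oplus>\<^bsub>quot_module ring_of_type_algebra J\<^esub> (J +>\<^bsub>ring_of_type_algebra\<^esub> b)
         = J +>\<^bsub>ring_of_type_algebra\<^esub> (a + b)"
    using a_rcos_sum[of a b] by (simp add: quot_module_def FactRing_def)
  show "a \<odot>\<^bsub>quot_module ring_of_type_algebra J\<^esub> (J +>\<^bsub>ring_of_type_algebra\<^esub> b)
         = J +>\<^bsub>ring_of_type_algebra\<^esub> (a * b)"
    using rcoset_mult_add[of a b] by (simp add: quot_module_def FactRing_def)
  show "\<zero>\<^bsub>quot_module ring_of_type_algebra J\<^esub> = J +>\<^bsub>ring_of_type_algebra\<^esub> 0"
    by (simp add: quot_module_def FactRing_def a_r_coset_type)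
qed

lemma abelian_group_quot_module:
  fixes J :: "'a::comm_ring_1 set"
  assumes "is_ideal J" shows "abelian_group (quot_module ring_of_type_algebra J)"
proof (rule abelian_groupI)
  fix x assume "x \<in> carrier (quot_module ring_of_type_algebra J)"
  then obtain a where a: "x = J +>\<^bsub>ring_of_type_algebra\<^esub> a" by (auto simp: carrier_quot_module)
  show "\<exists>y\<in>carrier (quot_module ring_of_type_algebra J).
      y \<oplus>\<^bsub>quot_module ring_of_type_algebra J\<^esub> x = \<zero>\<^bsub>quot_module ring_of_type_algebra J\<^esub>"
    unfolding a
    by (rule bexI[of _ "J +>\<^bsub>ring_of_type_algebra\<^esub> (- a)"])
       (simp_all add: quot_module_ops[OF assms] carrier_quot_module)
qed (auto simp: carrier_quot_module quot_module_ops[OF assms] algebra_simps)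

lemma finsum_quot_module:
  fixes J :: "'a::comm_ring_1 set" and h :: "nat \<Rightarrow> 'a"
  assumes "is_ideal J"
  shows "finsum (quot_module ring_of_type_algebra J) (\<lambda>i. J +>\<^bsub>ring_of_type_algebra\<^esub> h i) {..<n}
    = J +>\<^bsub>ring_of_type_algebra\<^esub> (\<Sum>i<n. h i)"
proof -
  interpret abelian_group "quot_module ring_of_type_algebra J"
    by (rule abelian_group_quot_module[OF assms])
  show ?thesis
  proof (induction n)
    case 0 then show ?case by (simp add: quot_module_ops[OF assms])
  next
    case (Suc n)
    have "finsum (quot_module ring_of_type_algebra J) (\<lambda>i. J +>\<^bsub>ring_of_type_algebra\<^esub> h i) (insert n {..<n})
      = (J +>\<^bsub>ring_of_type_algebra\<^esub> h n) \<oplus>\<^bsub>quot_module ring_of_type_algebra J\<^esub>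
        finsum (quot_module ring_of_type_algebra J) (\<lambda>i. J +>\<^bsub>ring_of_type_algebra\<^esub> h i) {..<n}"
      by (rule finsum_insert) (auto simp: carrier_quot_module)
    then show ?case
      by (simp add: Suc quot_module_ops[OF assms] lessThan_Suc add.commute)
  qed
qed

lemma seq_submodule_quot_module:
  fixes J :: "'a::comm_ring_1 set"
  assumes J: "is_ideal J"
  shows "seq_submodule ring_of_type_algebra (quot_module ring_of_type_algebra J) gs
    = (\<lambda>a. J +>\<^bsub>ring_of_type_algebra\<^esub> a) ` foldl extend J gs"
proof -
  interpret abelian_group "quot_module ring_of_type_algebra J"
    by (rule abelian_group_quot_module[OF assms])
  let ?c = "\<lambda>a. J +>\<^bsub>ring_of_type_algebra\<^esub> a"
  let ?M = "quot_module ring_of_type_algebra J"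
  have fs: "finsum ?M (\<lambda>i. gs ! i \<odot>\<^bsub>?M\<^esub> ?c (h i)) {..<length gs} = ?c (\<Sum>i<length gs. gs ! i * h i)" for h
    by (simp add: quot_module_ops[OF J] finsum_quot_module[OF J])
  show ?thesis
  proof safe
    fix x assume "x \<in> seq_submodule ring_of_type_algebra ?M gs"
    then obtain g where x: "x = finsum ?M (\<lambda>i. gs ! i \<odot>\<^bsub>?M\<^esub> g i) {..<length gs}"
      and g: "g \<in> {..<length gs} \<rightarrow> carrier ?M" by (auto simp: seq_submodule_def)
    have "\<forall>i. \<exists>a. i < length gs \<longrightarrow> g i = ?c a" using g by (auto simp: carrier_quot_module Pi_iff)
    then obtain h where h: "\<And>i. i < length gs \<Longrightarrow> g i = ?c (h i)" by metis
    have "x = finsum ?M (\<lambda>i. gs ! i \<odot>\<^bsub>?M\<^esub> ?c (h i)) {..<length gs}"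
      unfolding x by (rule finsum_cong') (auto simp: h quot_module_ops[OF J] carrier_quot_module)
    then have "x = ?c (\<Sum>i<length gs. gs ! i * h i)" by (simp add: fs)
    moreover have "(\<Sum>i<length gs. gs ! i * h i) \<in> foldl extend J gs"
      using is_ideal_zero[OF J] by (auto simp: foldl_extend_iff intro!: exI[of _ h])
    ultimately show "x \<in> ?c ` foldl extend J gs" by blast
  next
    fix f assume "f \<in> foldl extend J gs"
    then obtain h where "f - (\<Sum>i<length gs. gs ! i * h i) \<in> J" by (auto simp: foldl_extend_iff)
    then have "?c f = finsum ?M (\<lambda>i. gs ! i \<odot>\<^bsub>?M\<^esub> ?c (h i)) {..<length gs}"
      by (simp add: fs coset_eq_iff[OF J])
    then show "?c f \<in> seq_submodule ring_of_type_algebra ?M gs"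
      unfolding seq_submodule_def
      by (intro CollectI exI[of _ "\<lambda>i. ?c (h i)"]) (auto simp: carrier_quot_module)
  qed
qed

lemma is_ideal_foldl_extend: "is_ideal J \<Longrightarrow> is_ideal (foldl extend J gs)"
  by (induction gs arbitrary: J) (auto intro: is_ideal_extend)

lemma subset_foldl_extend: "J \<subseteq> foldl extend J gs"
proof (induction gs arbitrary: J)
  case (Cons g gs)
  show ?case using subset_extend[of J g] Cons[of "extend J g"] by simp
qed simp

lemma regular_sequence_quot_module:
  fixes J :: "'a::comm_ring_1 set"
  assumes J: "is_ideal J" and "wreg J gs" and "1 \<notin> foldl extend J gs"
  shows "regular_sequence ring_of_type_algebra (quot_module ring_of_type_algebra J) gs"
proof -
  let ?c = "\<lambda>a. J +>\<^bsub>ring_of_type_algebra\<^esub> a"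
  \<comment> \<open>An ideal containing J is a union of cosets of J, so membership of a coset can be
    tested on any representative.\<close>
  have mem: "?c f \<in> ?c ` foldl extend J gs \<longleftrightarrow> f \<in> foldl extend J gs" for f gs
  proof
    assume "?c f \<in> ?c ` foldl extend J gs"
    then obtain f' where "f - f' \<in> J" "f' \<in> foldl extend J gs" by (auto simp: coset_eq_iff[OF J])
    then show "f \<in> foldl extend J gs"
      using is_ideal_cong[OF is_ideal_foldl_extend[OF J], of f f' gs] subset_foldl_extend[of J gs] by auto
  qed auto
  have "?c 1 \<notin> ?c ` foldl extend J gs" using assms(3) mem by blast
  then have "?c ` foldl extend J gs \<noteq> range ?c" by blast
  moreover have "f \<in> foldl extend J (take i gs)"
    if "i < length gs" "gs ! i * f \<in> foldl extend J (take i gs)" for i f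
    using wreg_nthD[OF assms(2) that] .
  ultimately show ?thesis
    unfolding regular_sequence_def seq_submodule_quot_module[OF J] carrier_quot_module
    by (auto simp only: quot_module_ops[OF J] mem ball_simps ring_of_type_algebra_simps)
qed

section \<open>Monomial ideals\<close>

abbreviation "lookup \<equiv> Poly_Mapping.lookup"
abbreviation "keys \<equiv> Poly_Mapping.keys"
abbreviation "single \<equiv> Poly_Mapping.single"

lemma sum_single_lookup: "(\<Sum>a\<in>keys f. single a (lookup f a)) = f"
proof (rule poly_mapping_eqI)
  fix k
  have "lookup (\<Sum>a\<in>keys f. single a (lookup f a)) k = (\<Sum>a\<in>keys f. if a = k then lookup f a else 0)"
    by (auto simp: lookup_sum lookup_single when_def intro!: sum.cong)
  also have "\<dots> = lookup f k" by (simp add: sum.delta' in_keys_iff)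
  finally show "lookup (\<Sum>a\<in>keys f. single a (lookup f a)) k = lookup f k" .
qed

lemma lookup_mult_sum:
  fixes f g :: "'a::comm_monoid_add \<Rightarrow>\<^sub>0 'b::comm_semiring_0"
  shows "lookup (f * g) k
    = (\<Sum>a\<in>keys f. \<Sum>b\<in>keys g. if a + b = k then lookup f a * lookup g b else 0)"
proof -
  have "f * g = (\<Sum>a\<in>keys f. single a (lookup f a)) * (\<Sum>b\<in>keys g. single b (lookup g b))"
    by (simp add: sum_single_lookup)
  also have "\<dots> = (\<Sum>a\<in>keys f. \<Sum>b\<in>keys g. single (a + b) (lookup f a * lookup g b))"
    by (simp add: sum_product mult_single)
  finally have e: "f * g = (\<Sum>a\<in>keys f. \<Sum>b\<in>keys g. single (a + b) (lookup f a * lookup g b))" .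
  show ?thesis
    unfolding e by (auto simp: lookup_sum lookup_single when_def intro!: sum.cong)
qed

lemma in_keys_multE:
  fixes f g :: "'a::comm_monoid_add \<Rightarrow>\<^sub>0 'b::comm_semiring_0"
  assumes "k \<in> keys (f * g)" obtains a b where "k = a + b" "a \<in> keys f" "b \<in> keys g"
  using assms keys_mult[of f g] by blast

lemma lookup_single_mult:
  fixes h :: "'a::cancel_comm_monoid_add \<Rightarrow>\<^sub>0 'b::comm_semiring_1"
  shows "lookup (single m c * h) (m + n) = c * lookup h n"
proof (cases "c = 0")
  case False
  then have "lookup (single m c * h) (m + n) = (\<Sum>b\<in>keys h. if b = n then c * lookup h b else 0)"
    by (auto simp: lookup_mult_sum intro!: sum.cong)
  also have "\<dots> = c * lookup h n" by (simp add: sum.delta in_keys_iff)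
  finally show ?thesis .
qed simp

lemma keys_monomial_mult:
  fixes h :: "'a::cancel_comm_monoid_add \<Rightarrow>\<^sub>0 'b::comm_semiring_1"
  shows "keys (single m 1 * h) = (+) m ` keys h"
proof
  show "keys (single m 1 * h) \<subseteq> (+) m ` keys h"
    using keys_mult[of "single m 1" h] by auto
  show "(+) m ` keys h \<subseteq> keys (single m 1 * h)"
    by (auto simp: in_keys_iff lookup_single_mult)
qed

definition upset :: "'a::plus set \<Rightarrow> bool" where
  "upset N \<longleftrightarrow> (\<forall>n\<in>N. \<forall>m. m + n \<in> N)"

text \<open>For an \<open>upset\<close> this is a monomial ideal. Membership depends only on the
  exponents that occur, so colons by a monomial and sums with a monomial become operations on sets
  of exponents.\<close>

definition mideal :: "'a set \<Rightarrow> ('a \<Rightarrow>\<^sub>0 'b::zero) set" where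
  "mideal N = {f. keys f \<subseteq> N}"

lemma is_ideal_mideal:
  fixes N :: "'a::comm_monoid_add set"
  assumes "upset N" shows "is_ideal (mideal N :: ('a \<Rightarrow>\<^sub>0 'b::comm_ring_1) set)"
proof (rule is_idealI)
  fix a b :: "'a \<Rightarrow>\<^sub>0 'b" assume "a \<in> mideal N" "b \<in> mideal N"
  then show "a + b \<in> mideal N" using keys_add[of a b] by (auto simp: mideal_def)
next
  fix a r :: "'a \<Rightarrow>\<^sub>0 'b" assume "a \<in> mideal N"
  then show "r * a \<in> mideal N"
    using assms keys_mult[of r a] unfolding mideal_def upset_def by blast
qed (simp add: mideal_def)

lemma colon_mideal:
  fixes N :: "'a::cancel_comm_monoid_add set"
  shows "colon (mideal N) (single m (1::'b::comm_ring_1)) = mideal {n. m + n \<in> N}"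
  by (auto simp: colon_def mideal_def keys_monomial_mult)

lemma keys_sum_single: "finite A \<Longrightarrow> keys (\<Sum>a\<in>A. single a (c a)) \<subseteq> A"
  using keys_sum[of "\<lambda>a. single a (c a)" A] by (auto split: if_splits)

lemma extend_mideal:
  fixes N :: "'a::cancel_comm_monoid_add set"
  assumes "upset N"
  shows "extend (mideal N) (single m (1::'b::comm_ring_1)) = mideal (N \<union> range ((+) m))"
proof safe
  fix f assume "f \<in> extend (mideal N) (single m (1::'b))"
  then obtain j h where "f = j + single m 1 * h" "keys j \<subseteq> N" by (auto simp: mideal_def elim!: extendE)
  then show "f \<in> mideal (N \<union> range ((+) m))"
    using keys_add[of j "single m 1 * h"] by (auto simp: mideal_def keys_monomial_mult)
next
  fix f :: "'a \<Rightarrow>\<^sub>0 'b" assume f: "f \<in> mideal (N \<union> range ((+) m))"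
  let ?s = "\<lambda>a. single a (lookup f a)"
  have "(\<Sum>a\<in>keys f - N. ?s a) = single m 1 * (\<Sum>a\<in>keys f - N. single (a - m) (lookup f a))"
    unfolding sum_distrib_left using f by (intro sum.cong) (auto simp: mult_single mideal_def)
  moreover have "f = (\<Sum>a\<in>keys f \<inter> N. ?s a) + (\<Sum>a\<in>keys f - N. ?s a)"
    using sum.Int_Diff[of "keys f" ?s N] by (simp add: sum_single_lookup)
  moreover have "(\<Sum>a\<in>keys f \<inter> N. ?s a) \<in> mideal N"
    using keys_sum_single[of "keys f \<inter> N"] by (auto simp: mideal_def)
  ultimately show "f \<in> extend (mideal N) (single m (1::'b))" by (intro extendI) simp_all
qed

lemma wreg_mideal_filtration:
  fixes N :: "'a::cancel_comm_monoid_add set" and gs :: "('a \<Rightarrow>\<^sub>0 'b::comm_ring_1) list"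
  assumes "upset N" "wreg (mideal {n. m + n \<in> N}) gs" "wreg (mideal (N \<union> range ((+) m))) gs"
  shows "wreg (mideal N) gs"
proof (rule wreg_filtration[OF is_ideal_mideal[OF assms(1)]])
  show "wreg (colon (mideal N) (single m 1)) gs" unfolding colon_mideal by (rule assms(2))
  show "wreg (extend (mideal N) (single m 1)) gs" unfolding extend_mideal[OF assms(1)] by (rule assms(3))
qed

section \<open>Leading monomials\<close>

text \<open>The vertices carry no linear order. Numbering them moves exponent vectors into
  \<open>nat \<Rightarrow>\<^sub>0 nat\<close>, whose linear order is compatible with addition and
  can serve as a monomial order.\<close>

definition reindex :: "('v::finite \<Rightarrow>\<^sub>0 nat) \<Rightarrow> nat \<Rightarrow>\<^sub>0 nat" where
  "reindex m = (\<Sum>v\<in>UNIV. single (to_nat v) (lookup m v))"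

lemma reindex_add: "reindex (a + b) = reindex a + reindex b"
  by (simp add: reindex_def lookup_add single_add sum.distrib)

lemma reindex_inj: assumes "reindex a = reindex b" shows "a = b"
proof (rule poly_mapping_eqI)
  have "lookup (reindex m) (to_nat v) = lookup m v" for m and v :: 'a
    by (simp add: reindex_def lookup_sum lookup_single when_def sum.delta)
  then show "lookup a v = lookup b v" for v using assms by metis
qed

lemma ex_leading:
  fixes K :: "('v::finite \<Rightarrow>\<^sub>0 nat) set" and d :: "('v \<Rightarrow>\<^sub>0 nat) \<Rightarrow> nat"
  assumes "finite K" "K \<noteq> {}"
  obtains a where "a \<in> K" "\<And>a'. a' \<in> K \<Longrightarrow> d a \<le> d a'"
    "\<And>a'. a' \<in> K \<Longrightarrow> d a' = d a \<Longrightarrow> reindex a \<le> reindex a'"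
proof -
  have 1: "finite (d ` K)" "d ` K \<noteq> {}" using assms by auto
  let ?K = "{a\<in>K. d a = Min (d ` K)}"
  have "Min (d ` K) \<in> d ` K" using 1 by (rule Min_in)
  then obtain a0 where "a0 \<in> K" "d a0 = Min (d ` K)" by auto
  then have 2: "finite (reindex ` ?K)" "reindex ` ?K \<noteq> {}" using assms(1) by auto
  then have "Min (reindex ` ?K) \<in> reindex ` ?K" by (rule Min_in)
  then obtain a where a: "a \<in> K" "d a = Min (d ` K)" "reindex a = Min (reindex ` ?K)" by auto
  show thesis
  proof (rule that[OF a(1)])
    show "d a \<le> d a'" if "a' \<in> K" for a' using that 1 a(2) by simp
    show "reindex a \<le> reindex a'" if "a' \<in> K" "d a' = d a" for a'
      unfolding a(3) using that a(2) 2(1) by (intro Min_le) auto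
  qed
qed

text \<open>The witnesses have least weight \<open>d\<close>, with ties broken by a linear order on the monomials, so
  their sum arises in only one way.\<close>

lemma keys_mult_leading:
  fixes f g :: "('v::finite \<Rightarrow>\<^sub>0 nat) \<Rightarrow>\<^sub>0 'k::field"
  assumes d: "\<And>a b. d (a + b) = d a + (d b :: nat)" and fg: "f \<noteq> 0" "g \<noteq> 0"
  obtains a b where "a \<in> keys f" "b \<in> keys g" "a + b \<in> keys (f * g)"
    "\<And>a'. a' \<in> keys f \<Longrightarrow> d a \<le> d a'" "\<And>b'. b' \<in> keys g \<Longrightarrow> d b \<le> d b'"
proof -
  obtain a where a: "a \<in> keys f" "\<And>a'. a' \<in> keys f \<Longrightarrow> d a \<le> d a'"
    "\<And>a'. a' \<in> keys f \<Longrightarrow> d a' = d a \<Longrightarrow> reindex a \<le> reindex a'"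
    using ex_leading[of "keys f" d] fg by (metis finite_keys keys_eq_empty)
  obtain b where b: "b \<in> keys g" "\<And>a'. a' \<in> keys g \<Longrightarrow> d b \<le> d a'"
    "\<And>a'. a' \<in> keys g \<Longrightarrow> d a' = d b \<Longrightarrow> reindex b \<le> reindex a'"
    using ex_leading[of "keys g" d] fg by (metis finite_keys keys_eq_empty)
  have uniq: "a' + b' = a + b \<longleftrightarrow> a' = a \<and> b' = b" if "a' \<in> keys f" "b' \<in> keys g" for a' b'
  proof
    assume e: "a' + b' = a + b"
    have "d a' + d b' = d a + d b" using e d by metis
    then have "d a' = d a" "d b' = d b" using a(2)[OF that(1)] b(2)[OF that(2)] by auto
    then have le: "reindex a \<le> reindex a'" "reindex b \<le> reindex b'" using a(3) b(3) that by auto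
    have "reindex a' + reindex b' = reindex a + reindex b" using e reindex_add by metis
    then have "reindex a' = reindex a"
      using le add_less_le_mono[of "reindex a" "reindex a'" "reindex b" "reindex b'"]
      by (metis order_le_less less_irrefl)
    then have "a' = a" by (rule reindex_inj)
    then show "a' = a \<and> b' = b" using e by simp
  qed simp
  have "lookup (f * g) (a + b) = (\<Sum>a'\<in>keys f. \<Sum>b'\<in>keys g.
      if b' = b then if a' = a then lookup f a * lookup g b else 0 else 0)"
    unfolding lookup_mult_sum by (intro sum.cong refl) (auto simp: uniq)
  also have "\<dots> = lookup f a * lookup g b"
    using a(1) b(1) by (simp add: sum.delta)
  finally have "a + b \<in> keys (f * g)" using a(1) b(1) by (simp add: in_keys_iff)
  then show thesis using that a b by blast
qed

lemma mpoly_mult_eq_0: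
  fixes f g :: "('v::finite \<Rightarrow>\<^sub>0 nat) \<Rightarrow>\<^sub>0 'k::field"
  assumes "f * g = 0" shows "f = 0 \<or> g = 0"
proof (rule ccontr)
  assume "\<not> ?thesis"
  then show False using keys_mult_leading[of "\<lambda>_. 0" f g] assms by auto
qed

section \<open>The second symbolic power of an edge ideal\<close>

lemma add_diff_pointwise:
  fixes m a :: "'v \<Rightarrow>\<^sub>0 nat"
  assumes "\<And>v. lookup m v \<le> lookup a v" shows "m + (a - m) = a"
  by (rule poly_mapping_eqI) (simp add: lookup_add lookup_minus assms)

lemma range_plus: "range ((+) m) = {n. \<forall>v. lookup m v \<le> lookup n v}" for m :: "'v \<Rightarrow>\<^sub>0 nat"
proof safe
  fix n assume "\<forall>v. lookup m v \<le> lookup n v"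
  then have "n = m + (n - m)" by (simp add: add_diff_pointwise)
  then show "n \<in> range ((+) m)" by blast
qed (simp add: lookup_add)

lemma Var_mult_single: "Var v * single m c = single (single v 1 + m) c"
  by (simp add: Var_def mult_single)

lemma Var_mult_Var: "Var x * Var y = single (single x 1 + single y 1) 1"
  by (simp add: Var_def mult_single)

section \<open>Degrees on a set of variables and the primes of vertex covers\<close>

definition cdeg :: "'v::finite set \<Rightarrow> ('v \<Rightarrow>\<^sub>0 nat) \<Rightarrow> nat" where
  "cdeg C m = (\<Sum>v\<in>C. lookup m v)"

lemma cdeg_add: "cdeg C (a + b) = cdeg C a + cdeg C b"
  by (simp add: cdeg_def lookup_add sum.distrib)

lemma cdeg_single: "cdeg C (single v k) = (if v \<in> C then k else 0)"
  by (simp add: cdeg_def lookup_single when_def sum.delta)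

lemma cdeg_mono: "C \<subseteq> D \<Longrightarrow> cdeg C m \<le> cdeg D m"
  unfolding cdeg_def by (intro sum_mono2) auto

lemma upset_cdeg: "upset {n. k \<le> cdeg C n}"
  by (auto simp: upset_def cdeg_add)

lemma cdeg_pos_split:
  assumes "0 < cdeg C a" obtains v b where "v \<in> C" "a = single v 1 + b"
proof -
  obtain v where v: "v \<in> C" "lookup a v \<noteq> 0"
    using assms unfolding cdeg_def by (metis less_irrefl sum.neutral)
  have "single v 1 + (a - single v 1) = a"
    using v(2) by (intro add_diff_pointwise) (auto simp: lookup_single when_def)
  then show thesis using that[of v "a - single v 1"] v(1) by simp
qed

definition cover_prime :: "'v::finite set \<Rightarrow> ('v, 'k::field) mpoly set" where
  "cover_prime C = mideal {n. 1 \<le> cdeg C n}"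

definition vertex_cover :: "'v set set \<Rightarrow> 'v set \<Rightarrow> bool" where
  "vertex_cover E C \<longleftrightarrow> (\<forall>x y. {x, y} \<in> E \<longrightarrow> x \<in> C \<or> y \<in> C)"

lemma is_ideal_cover_prime: "is_ideal (cover_prime C)"
  unfolding cover_prime_def by (intro is_ideal_mideal upset_cdeg)

text \<open>The k-th power of the prime of C is primary: u has a monomial of C-degree 0, so the
  least C-degree in u f is the least C-degree in f. The case k = 1 gives primality of
  \<open>cover_prime C\<close>.\<close>

lemma mideal_cdeg_primary:
  fixes u f :: "('v::finite, 'k::field) mpoly"
  assumes "u * f \<in> mideal {n. k \<le> cdeg C n}" "u \<notin> cover_prime C"
  shows "f \<in> mideal {n. k \<le> cdeg C n}"
proof (cases "f = 0")
  case False
  have "u \<noteq> 0" using assms(2) by (auto simp: cover_prime_def mideal_def)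
  then obtain a b where ab: "a \<in> keys u" "b \<in> keys f" "a + b \<in> keys (u * f)"
    "\<And>a'. a' \<in> keys u \<Longrightarrow> cdeg C a \<le> cdeg C a'" "\<And>b'. b' \<in> keys f \<Longrightarrow> cdeg C b \<le> cdeg C b'"
    using keys_mult_leading[of "cdeg C" u f] False cdeg_add by metis
  obtain a' where "a' \<in> keys u" "\<not> 1 \<le> cdeg C a'"
    using assms(2) by (auto simp: cover_prime_def mideal_def)
  then have "cdeg C a = 0" using ab(4)[of a'] by simp
  moreover have "k \<le> cdeg C (a + b)" using ab(3) assms(1) by (auto simp: mideal_def)
  ultimately have "k \<le> cdeg C b" by (simp add: cdeg_add)
  then show ?thesis using ab(5) by (force simp: mideal_def)
qed (simp add: mideal_def)

lemma Var_in_cover_prime [simp]: "Var v \<in> cover_prime C \<longleftrightarrow> v \<in> C"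
  by (simp add: Var_def cover_prime_def mideal_def cdeg_single)

lemma primeideal_type:
  fixes p :: "'a::comm_ring_1 set"
  shows "primeideal p ring_of_type_algebra
    \<longleftrightarrow> is_ideal p \<and> p \<noteq> UNIV \<and> (\<forall>a b. a * b \<in> p \<longrightarrow> a \<in> p \<or> b \<in> p)"
  using cring_from_type_algebra
  unfolding primeideal_def primeideal_axioms_def ideal_iff_is_ideal by auto

lemma primeideal_cover_prime: "primeideal (cover_prime C :: ('v::finite, 'k::field) mpoly set) mpoly_ring"
  unfolding primeideal_type
proof (intro conjI allI impI is_ideal_cover_prime)
  have "1 \<notin> cover_prime C" by (simp add: cover_prime_def mideal_def cdeg_def)
  then show "cover_prime C \<noteq> UNIV" by blast
  fix a b :: "('v, 'k) mpoly" assume "a * b \<in> cover_prime C"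
  then show "a \<in> cover_prime C \<or> b \<in> cover_prime C"
    using mideal_cdeg_primary[of a b 1 C] by (auto simp: cover_prime_def)
qed

lemma edge_ideal_subset_iff:
  fixes K :: "('v::finite, 'k::field) mpoly set"
  assumes "is_ideal K"
  shows "edge_ideal E \<subseteq> K \<longleftrightarrow> (\<forall>x y. {x, y} \<in> E \<longrightarrow> Var x * Var y \<in> K)"
proof -
  interpret cring "mpoly_ring :: ('v, 'k) mpoly ring" by (rule cring_from_type_algebra)
  let ?G = "{Var x * Var y | x y. {x, y} \<in> E} :: ('v, 'k) mpoly set"
  have "ideal K mpoly_ring" using assms by (simp add: ideal_iff_is_ideal)
  then have "Idl\<^bsub>mpoly_ring\<^esub> ?G \<subseteq> K \<longleftrightarrow> ?G \<subseteq> K"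
    using genideal_minimal[of K ?G] genideal_self[of ?G] by auto
  then show ?thesis unfolding edge_ideal_def by blast
qed

lemma is_ideal_edge_ideal: "is_ideal (edge_ideal E :: ('v::finite, 'k::field) mpoly set)"
proof -
  interpret cring "mpoly_ring :: ('v, 'k) mpoly ring" by (rule cring_from_type_algebra)
  show ?thesis unfolding edge_ideal_def ideal_iff_is_ideal[symmetric] by (rule genideal_ideal) simp
qed

lemma edge_in_edge_ideal:
  fixes E :: "'v::finite set set"
  assumes "{x, y} \<in> E" shows "Var x * Var y \<in> (edge_ideal E :: ('v, 'k::field) mpoly set)"
  using edge_ideal_subset_iff[where K = "edge_ideal E :: ('v, 'k) mpoly set", OF is_ideal_edge_ideal, of E] assms
  by simp

lemma edge_ideal_subset_cover_prime:
  assumes "vertex_cover E C" shows "edge_ideal E \<subseteq> cover_prime C"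
  unfolding edge_ideal_subset_iff[OF is_ideal_cover_prime]
proof (intro allI impI)
  fix x y assume "{x, y} \<in> E"
  then have "x \<in> C \<or> y \<in> C" using assms by (auto simp: vertex_cover_def)
  then show "Var x * Var y \<in> cover_prime C"
    by (auto intro: is_ideal_mult[OF is_ideal_cover_prime] is_ideal_mult_right[OF is_ideal_cover_prime])
qed

text \<open>Primality puts an end of each edge into p, so the variables in p form a cover; a
  monomial of positive degree on this cover is divisible by one of them. Thus every prime over the
  edge ideal lies above a \<open>cover_prime\<close>, and only those can be minimal.\<close>

lemma prime_contains_cover_prime:
  fixes p :: "('v::finite, 'k::field) mpoly set"
  assumes p: "primeideal p mpoly_ring" and E: "edge_ideal E \<subseteq> p"
  shows "vertex_cover E {v. Var v \<in> p}" "cover_prime {v. Var v \<in> p} \<subseteq> p"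
proof -
  have pi: "is_ideal p" and pp: "\<And>a b. a * b \<in> p \<Longrightarrow> a \<in> p \<or> b \<in> p"
    using p by (auto simp: primeideal_type)
  show "vertex_cover E {v. Var v \<in> p}"
    using E pp by (auto simp: vertex_cover_def edge_ideal_subset_iff[OF pi])
  show "cover_prime {v. Var v \<in> p} \<subseteq> p"
  proof
    fix f :: "('v, 'k) mpoly" assume f: "f \<in> cover_prime {v. Var v \<in> p}"
    have "(\<Sum>a\<in>keys f. single a (lookup f a)) \<in> p"
    proof (rule is_ideal_sum[OF pi])
      fix a assume "a \<in> keys f"
      then have "0 < cdeg {v. Var v \<in> p} a" using f by (auto simp: cover_prime_def mideal_def)
      then obtain v b where "Var v \<in> p" "a = single v 1 + b" by (auto elim: cdeg_pos_split)
      then show "single a (lookup f a) \<in> p"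
        using is_ideal_mult_right[OF pi, of "Var v" "single b (lookup f a)"]
        by (simp add: Var_mult_single)
    qed
    then show "f \<in> p" by (simp add: sum_single_lookup)
  qed
qed

definition minimal_cover :: "'v set set \<Rightarrow> 'v set \<Rightarrow> bool" where
  "minimal_cover E C \<longleftrightarrow> vertex_cover E C \<and> (\<forall>D. vertex_cover E D \<longrightarrow> D \<subseteq> C \<longrightarrow> D = C)"

lemma minimal_primes_edge_ideal:
  "minimal_primes mpoly_ring (edge_ideal E :: ('v::finite, 'k::field) mpoly set)
    = cover_prime ` {C. minimal_cover E C}"
proof safe
  fix p :: "('v, 'k) mpoly set" assume "p \<in> minimal_primes mpoly_ring (edge_ideal E)"
  then have p: "primeideal p mpoly_ring" "edge_ideal E \<subseteq> p"
    and min: "\<And>q. primeideal q mpoly_ring \<Longrightarrow> edge_ideal E \<subseteq> q \<Longrightarrow> q \<subseteq> p \<Longrightarrow> q = p"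
    by (auto simp: minimal_primes_def)
  let ?C = "{v. Var v \<in> p}"
  note C = prime_contains_cover_prime[OF p]
  have eq: "cover_prime ?C = p"
    using C by (intro min primeideal_cover_prime edge_ideal_subset_cover_prime)
  have "minimal_cover E ?C"
    unfolding minimal_cover_def
  proof (intro conjI allI impI C)
    fix D assume D: "vertex_cover E D" "D \<subseteq> ?C"
    have "cover_prime D \<subseteq> (cover_prime ?C :: ('v, 'k) mpoly set)"
      using cdeg_mono[OF D(2)] unfolding cover_prime_def mideal_def by (blast intro: order_trans)
    then have eqD: "cover_prime D = p"
      using D eq by (intro min primeideal_cover_prime edge_ideal_subset_cover_prime) auto
    have "Var v \<in> p \<longleftrightarrow> v \<in> D" for v unfolding eqD[symmetric] by simp
    then show "D = ?C" by auto
  qed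
  then show "p \<in> cover_prime ` {C. minimal_cover E C}" using eq by blast
next
  fix C assume C: "minimal_cover E C"
  show "cover_prime C \<in> minimal_primes mpoly_ring (edge_ideal E :: ('v, 'k) mpoly set)"
    unfolding minimal_primes_def
  proof (intro CollectI conjI allI impI primeideal_cover_prime)
    show "edge_ideal E \<subseteq> (cover_prime C :: ('v, 'k) mpoly set)"
      using C by (auto simp: minimal_cover_def intro!: edge_ideal_subset_cover_prime)
    fix q :: "('v, 'k) mpoly set"
    assume q: "primeideal q mpoly_ring \<and> edge_ideal E \<subseteq> q \<and> q \<subseteq> cover_prime C"
    note D = prime_contains_cover_prime[of q E]
    have "{v. Var v \<in> q} \<subseteq> C" using q by auto
    then have "{v. Var v \<in> q} = C" using C D q unfolding minimal_cover_def by blast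
    then show "q = cover_prime C" using D q by auto
  qed
qed

lemma loc_kernel_type:
  fixes J p :: "'a::comm_ring_1 set"
  assumes J: "is_ideal J" and p: "primeideal p ring_of_type_algebra"
  shows "loc_kernel ring_of_type_algebra J p = {f. \<exists>u. u \<notin> p \<and> u * f \<in> J}"
proof -
  let ?R = "ring_of_type_algebra :: 'a ring"
  let ?M = "quot_module ?R J"
  let ?c = "\<lambda>a. J +>\<^bsub>?R\<^esub> a"
  interpret abelian_group ?M by (rule abelian_group_quot_module[OF J])
  have pI: "is_ideal p" and "p \<noteq> UNIV" and pp: "\<And>a b. a \<notin> p \<Longrightarrow> b \<notin> p \<Longrightarrow> a * b \<notin> p"
    using p by (auto simp: primeideal_type)
  then have one: "1 \<notin> p" using is_ideal_mult[OF pI, of 1] by auto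
  have "\<ominus>\<^bsub>?M\<^esub> ?c b = ?c (- b)" for b
    by (rule minus_equality) (simp_all add: quot_module_ops[OF J] carrier_quot_module)
  then have diff: "?c a \<ominus>\<^bsub>?M\<^esub> ?c b = ?c (a - b)" for a b
    by (simp add: a_minus_def quot_module_ops[OF J])
  have rel: "((?c a, s), (?c b, t)) \<in> frac_rel ?R ?M (UNIV - p)
      \<longleftrightarrow> s \<notin> p \<and> t \<notin> p \<and> (\<exists>u. u \<notin> p \<and> u * (t * a - s * b) \<in> J)" for a b s t
    unfolding frac_rel_def
    by (auto simp: quot_module_ops[OF J] carrier_quot_module diff coset_eq_iff[OF J])
  have car: "y \<in> carrier ?M" if "((x, s), (y, t)) \<in> frac_rel ?R ?M (UNIV - p)" for x s y t
    using that by (auto simp: frac_rel_def)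
  have "frac ?R ?M (UNIV - p) (?c f) 1 = frac ?R ?M (UNIV - p) (?c 0) 1 \<longleftrightarrow> (\<exists>u. u \<notin> p \<and> u * f \<in> J)"
    for f
  proof
    assume e: "frac ?R ?M (UNIV - p) (?c f) 1 = frac ?R ?M (UNIV - p) (?c 0) 1"
    have "((?c f, 1), (?c f, 1)) \<in> frac_rel ?R ?M (UNIV - p)"
      unfolding rel using one is_ideal_zero[OF J] by auto
    then have "(?c f, 1) \<in> frac ?R ?M (UNIV - p) (?c 0) 1" using e by (auto simp: frac_def)
    then have "((?c 0, 1), (?c f, 1)) \<in> frac_rel ?R ?M (UNIV - p)" by (auto simp: frac_def)
    then obtain u where "u \<notin> p" "- (u * f) \<in> J" unfolding rel by auto
    then show "\<exists>u. u \<notin> p \<and> u * f \<in> J" using is_ideal_uminus[OF J, of "- (u * f)"] by auto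
  next
    assume "\<exists>u. u \<notin> p \<and> u * f \<in> J"
    then obtain u where u: "u \<notin> p" "u * f \<in> J" by blast
    have "((?c f, 1), (?c b, t)) \<in> frac_rel ?R ?M (UNIV - p)
      \<longleftrightarrow> ((?c 0, 1), (?c b, t)) \<in> frac_rel ?R ?M (UNIV - p)" for b t
    proof -
      \<comment> \<open>Multiplying by u absorbs the term containing f, because
        \<open>u * f \<in> J\<close>, and \<open>u * w\<close> stays outside p. Hence f/1 and 0/1
        are related to the same pairs.\<close>
      have tr: "(u * w) * (t * f - b) \<in> J \<longleftrightarrow> u * w * (- b) \<in> J" for w
        by (rule is_ideal_cong[OF J])
           (use is_ideal_mult[OF J u(2), of "w * t"] in \<open>simp add: algebra_simps\<close>)
      have "(\<exists>w. w \<notin> p \<and> w * (t * f - b) \<in> J) \<longleftrightarrow> (\<exists>w. w \<notin> p \<and> w * (- b) \<in> J)"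
      proof
        assume "\<exists>w. w \<notin> p \<and> w * (t * f - b) \<in> J"
        then obtain w where w: "w \<notin> p" "w * (t * f - b) \<in> J" by blast
        have "u * w * (t * f - b) \<in> J" using is_ideal_mult[OF J w(2), of u] by (simp add: mult.assoc)
        then show "\<exists>w. w \<notin> p \<and> w * (- b) \<in> J" using tr pp[OF u(1) w(1)] by blast
      next
        assume "\<exists>w. w \<notin> p \<and> w * (- b) \<in> J"
        then obtain w where w: "w \<notin> p" "w * (- b) \<in> J" by blast
        have "u * w * (- b) \<in> J" using is_ideal_mult[OF J w(2), of u] by (simp add: mult.assoc)
        then show "\<exists>w. w \<notin> p \<and> w * (t * f - b) \<in> J" using tr pp[OF u(1) w(1)] by blast
      qed
      then show ?thesis unfolding rel by simp
    qed
    then have "((?c f, 1), (y, t)) \<in> frac_rel ?R ?M (UNIV - p)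
      \<longleftrightarrow> ((?c 0, 1), (y, t)) \<in> frac_rel ?R ?M (UNIV - p)" for y t
      using car unfolding carrier_quot_module by blast
    then show "frac ?R ?M (UNIV - p) (?c f) 1 = frac ?R ?M (UNIV - p) (?c 0) 1"
      by (auto simp: frac_def)
  qed
  then show ?thesis by (simp add: loc_kernel_def quot_module_ops[OF J])
qed

text \<open>Powers start from the unit of the monoid of ideals, which is the whole ring; hence the
  factor \<open>UNIV\<close>.\<close>

lemma ideal_square:
  "I [^]\<^bsub>ideals_set ring_of_type_algebra\<^esub> (2::nat)
    = ideal_prod ring_of_type_algebra (ideal_prod ring_of_type_algebra UNIV I) I"
  for I :: "'a::comm_ring_1 set"
  by (simp add: nat_pow_def numeral_2_eq_2 ideals_set_def)

lemma ideal_prod_subset: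
  fixes A B K :: "'a::comm_ring_1 set"
  assumes "is_ideal K" "\<And>a b. a \<in> A \<Longrightarrow> b \<in> B \<Longrightarrow> a * b \<in> K"
  shows "ideal_prod ring_of_type_algebra A B \<subseteq> K"
proof
  fix s assume "s \<in> ideal_prod ring_of_type_algebra A B"
  then show "s \<in> K"
    by (induction rule: ideal_prod.induct) (simp_all add: assms(2) is_ideal_add[OF assms(1)])
qed

lemma is_ideal_square:
  fixes I :: "'a::comm_ring_1 set"
  assumes "is_ideal I" shows "is_ideal (I [^]\<^bsub>ideals_set ring_of_type_algebra\<^esub> (2::nat))"
proof -
  interpret cring "ring_of_type_algebra :: 'a ring" by (rule cring_from_type_algebra)
  have "is_ideal (UNIV :: 'a set)" by (simp add: is_ideal_def)
  then show ?thesis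
    unfolding ideal_square ideal_iff_is_ideal[symmetric]
    using assms by (intro ideal_prod_is_ideal) (simp_all add: ideal_iff_is_ideal)
qed

lemma mult_in_square:
  fixes a b :: "'a::comm_ring_1"
  assumes "a \<in> I" "b \<in> I" shows "a * b \<in> I [^]\<^bsub>ideals_set ring_of_type_algebra\<^esub> (2::nat)"
  using ideal_prod.prod[OF ideal_prod.prod[of 1 UNIV a I "ring_of_type_algebra"] assms(2), of "ring_of_type_algebra"]
    assms(1)
  by (simp add: ideal_square)

lemma edge_ideal_square_subset:
  assumes "vertex_cover E C"
  shows "(edge_ideal E :: ('v::finite, 'k::field) mpoly set) [^]\<^bsub>ideals_set mpoly_ring\<^esub> (2::nat)
    \<subseteq> mideal {n. 2 \<le> cdeg C n}"
proof -
  have 1: "edge_ideal E \<subseteq> (cover_prime C :: ('v, 'k) mpoly set)"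
    by (rule edge_ideal_subset_cover_prime[OF assms])
  have 2: "ideal_prod mpoly_ring UNIV (edge_ideal E) \<subseteq> (cover_prime C :: ('v, 'k) mpoly set)"
    using 1 by (intro ideal_prod_subset is_ideal_cover_prime is_ideal_mult) auto
  have 3: "a * b \<in> mideal {n. 2 \<le> cdeg C n}"
    if "a \<in> cover_prime C" "b \<in> cover_prime C" for a b :: "('v, 'k) mpoly"
    unfolding mideal_def
  proof safe
    fix k assume "k \<in> keys (a * b)"
    then obtain m n where "k = m + n" "m \<in> keys a" "n \<in> keys b" by (rule in_keys_multE)
    moreover then have "1 \<le> cdeg C m" "1 \<le> cdeg C n" using that by (auto simp: cover_prime_def mideal_def)
    ultimately show "2 \<le> cdeg C k" by (simp add: cdeg_add)
  qed
  show ?thesis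
    unfolding ideal_square using 1 2 3
    by (intro ideal_prod_subset is_ideal_mideal upset_cdeg) blast
qed

text \<open>Removing v from C uncovers some edge. As C itself covers this edge, it runs from v to a
  vertex outside C.\<close>

lemma minimal_cover_private_edge:
  assumes "simple_graph E" "minimal_cover E C" "v \<in> C"
  obtains w where "w \<notin> C" "{v, w} \<in> E"
proof -
  have "\<not> vertex_cover E (C - {v})" using assms unfolding minimal_cover_def by blast
  then obtain x y where xy: "{x, y} \<in> E" "x \<notin> C - {v}" "y \<notin> C - {v}" by (auto simp: vertex_cover_def)
  have "x \<noteq> y" using assms(1) xy(1) by (auto simp: simple_graph_def)
  moreover have "x \<in> C \<or> y \<in> C"
    using assms(2) xy(1) by (auto simp: minimal_cover_def vertex_cover_def)
  ultimately consider "x = v" "y \<notin> C" | "y = v" "x \<notin> C" using xy by blast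
  then show thesis by cases (use that xy in \<open>auto simp: insert_commute\<close>)
qed

definition symbolic_exponents :: "'v::finite set set \<Rightarrow> ('v \<Rightarrow>\<^sub>0 nat) set" where
  "symbolic_exponents E = {n. \<forall>C. vertex_cover E C \<longrightarrow> 2 \<le> cdeg C n}"

lemma ex_minimal_cover:
  fixes C :: "'v::finite set"
  assumes "vertex_cover E C" obtains D where "minimal_cover E D" "D \<subseteq> C"
proof -
  obtain D where D: "D \<in> {D. vertex_cover E D \<and> D \<subseteq> C}"
    and m: "\<And>D'. D' \<in> {D. vertex_cover E D \<and> D \<subseteq> C} \<Longrightarrow> D' \<subseteq> D \<Longrightarrow> D = D'"
    using finite_has_minimal[of "{D. vertex_cover E D \<and> D \<subseteq> C}"] assms by auto
  show thesis
  proof (rule that)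
    show "minimal_cover E D" using D m unfolding minimal_cover_def by blast
  qed (use D in simp)
qed

text \<open>A minimal cover \<open>C\<close> has a private edge at each of its vertices, so the square \<open>u\<close> of the product of
  the variables outside \<open>C\<close> multiplies every monomial of \<open>C\<close>-degree at least 2 into \<open>I(G)\<^sup>2\<close>.\<close>

lemma cdeg_two_in_loc:
  fixes f :: "('v::finite, 'k::field) mpoly"
  assumes E: "simple_graph E" and C: "minimal_cover E C" and f: "f \<in> mideal {n. 2 \<le> cdeg C n}"
  obtains u where "u \<notin> cover_prime C"
    "u * f \<in> (edge_ideal E) [^]\<^bsub>ideals_set mpoly_ring\<^esub> (2::nat)"
proof -
  let ?I2 = "(edge_ideal E :: ('v, 'k) mpoly set) [^]\<^bsub>ideals_set mpoly_ring\<^esub> (2::nat)"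
  have I2: "is_ideal ?I2" by (rule is_ideal_square[OF is_ideal_edge_ideal])
  \<comment> \<open>The exponent is 2 because the private neighbours w and w' found below for two
    factors of a monomial may coincide.\<close>
  define m :: "'v \<Rightarrow>\<^sub>0 nat" where "m = (\<Sum>w\<in>-C. single w 2)"
  have lm: "lookup m w = (if w \<in> C then 0 else 2)" for w
    by (simp add: m_def lookup_sum lookup_single when_def sum.delta)
  have "cdeg C m = 0" by (simp add: cdeg_def lm)
  then have u: "(single m 1 :: ('v, 'k) mpoly) \<notin> cover_prime C" by (simp add: cover_prime_def mideal_def)
  have "(\<Sum>a\<in>keys f. single m 1 * single a (lookup f a)) \<in> ?I2"
  proof (rule is_ideal_sum[OF I2])
    fix a assume "a \<in> keys f"
    then have a2: "2 \<le> cdeg C a" using f by (auto simp: mideal_def)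
    then obtain v b where v: "v \<in> C" "a = single v 1 + b" using cdeg_pos_split[of C a] by auto
    then have "0 < cdeg C b" using a2 by (simp add: cdeg_add cdeg_single)
    then obtain v' b' where v': "v' \<in> C" "b = single v' 1 + b'" by (rule cdeg_pos_split)
    obtain w where w: "w \<notin> C" "{v, w} \<in> E" using minimal_cover_private_edge[OF E C v(1)] .
    obtain w' where w': "w' \<notin> C" "{v', w'} \<in> E" using minimal_cover_private_edge[OF E C v'(1)] .
    have "m = (single w 1 + single w' 1) + (m - (single w 1 + single w' 1))"
      using w(1) w'(1)
      by (intro add_diff_pointwise[symmetric]) (auto simp: lookup_add lookup_single lm when_def)
    then obtain m' where m': "m = single w 1 + single w' 1 + m'" by blast
    have "m + a = (single v 1 + single w 1) + ((single v' 1 + single w' 1) + (m' + b'))"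
      unfolding m' v(2) v'(2) by (simp add: ac_simps)
    then have "single m 1 * single a (lookup f a)
      = (Var v * Var w) * ((Var v' * Var w') * single (m' + b') (lookup f a))"
      by (simp add: mult_single Var_mult_Var)
    also have "\<dots> \<in> ?I2"
      by (intro mult_in_square is_ideal_mult_right[OF is_ideal_edge_ideal] edge_in_edge_ideal w w')
    finally show "single m 1 * single a (lookup f a) \<in> ?I2" .
  qed
  then have "single m 1 * f \<in> ?I2" by (simp add: sum_single_lookup flip: sum_distrib_left)
  then show thesis using that u by blast
qed

text \<open>At a minimal cover C the localization kernel is the square of the prime of C: this
  square contains the square of the edge ideal and is primary, and conversely
  \<open>cdeg_two_in_loc\<close> provides the denominators. Other covers contain a minimal one and
  add no condition.\<close>

lemma symbolic_square:
  fixes E :: "'v::finite set set"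
  assumes E: "simple_graph E"
  shows "symbolic_power mpoly_ring (edge_ideal E :: ('v, 'k::field) mpoly set) 2
    = mideal (symbolic_exponents E)"
proof -
  let ?I2 = "(edge_ideal E :: ('v, 'k) mpoly set) [^]\<^bsub>ideals_set mpoly_ring\<^esub> (2::nat)"
  have loc: "f \<in> loc_kernel mpoly_ring ?I2 (cover_prime C) \<longleftrightarrow> f \<in> mideal {n. 2 \<le> cdeg C n}"
    if C: "minimal_cover E C" for C f
  proof -
    have "f \<in> mideal {n. 2 \<le> cdeg C n}" if "u \<notin> cover_prime C" "u * f \<in> ?I2" for u
    proof (rule mideal_cdeg_primary[OF _ that(1)])
      show "u * f \<in> mideal {n. 2 \<le> cdeg C n}"
        using edge_ideal_square_subset[of E C] C that(2) by (auto simp: minimal_cover_def)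
    qed
    then show ?thesis
      using cdeg_two_in_loc[OF E C, of f]
      unfolding loc_kernel_type[OF is_ideal_square[OF is_ideal_edge_ideal] primeideal_cover_prime]
      by blast
  qed
  have "f \<in> symbolic_power mpoly_ring (edge_ideal E) 2
    \<longleftrightarrow> (\<forall>C. minimal_cover E C \<longrightarrow> f \<in> mideal {n. 2 \<le> cdeg C n})" for f :: "('v, 'k) mpoly"
    using loc by (auto simp: symbolic_power_def minimal_primes_edge_ideal)
  moreover have "(\<forall>C. minimal_cover E C \<longrightarrow> f \<in> mideal {n. 2 \<le> cdeg C n})
    \<longleftrightarrow> f \<in> mideal (symbolic_exponents E)" for f :: "('v, 'k) mpoly"
  proof
    assume *: "\<forall>C. minimal_cover E C \<longrightarrow> f \<in> mideal {n. 2 \<le> cdeg C n}"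
    have "2 \<le> cdeg C n" if "n \<in> keys f" "vertex_cover E C" for n C
    proof -
      obtain D where D: "minimal_cover E D" "D \<subseteq> C" using ex_minimal_cover[OF \<open>vertex_cover E C\<close>] .
      then have "2 \<le> cdeg D n" using * that(1) by (auto simp: mideal_def)
      then show ?thesis using cdeg_mono[OF D(2), of n] by linarith
    qed
    then show "f \<in> mideal (symbolic_exponents E)" by (auto simp: mideal_def symbolic_exponents_def)
  next
    assume "f \<in> mideal (symbolic_exponents E)"
    then show "\<forall>C. minimal_cover E C \<longrightarrow> f \<in> mideal {n. 2 \<le> cdeg C n}"
      by (auto simp: mideal_def symbolic_exponents_def minimal_cover_def)
  qed
  ultimately show ?thesis by blast
qed

section \<open>Ideals generated by linear forms\<close>

definition monom_eval :: "('v::finite \<Rightarrow> 'a::comm_ring_1) \<Rightarrow> ('v \<Rightarrow>\<^sub>0 nat) \<Rightarrow> 'a" where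
  "monom_eval \<sigma> m = (\<Prod>v\<in>UNIV. \<sigma> v ^ lookup m v)"

definition subst :: "('v::finite \<Rightarrow> ('v, 'k::field) mpoly) \<Rightarrow> ('v, 'k) mpoly \<Rightarrow> ('v, 'k) mpoly" where
  "subst \<sigma> f = (\<Sum>a\<in>keys f. single 0 (lookup f a) * monom_eval \<sigma> a)"

lemma monom_eval_0 [simp]: "monom_eval \<sigma> 0 = 1"
  by (simp add: monom_eval_def)

lemma monom_eval_add: "monom_eval \<sigma> (a + b) = monom_eval \<sigma> a * monom_eval \<sigma> b"
  by (simp add: monom_eval_def lookup_add power_add prod.distrib)

lemma monom_eval_single: "monom_eval \<sigma> (single v 1) = \<sigma> v"
proof -
  have "monom_eval \<sigma> (single v 1) = (\<Prod>w\<in>UNIV. if w = v then \<sigma> w else 1)"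
    unfolding monom_eval_def by (intro prod.cong refl) (auto simp: lookup_single when_def)
  then show ?thesis by simp
qed

lemma subst_superset:
  assumes "finite A" "keys f \<subseteq> A"
  shows "subst \<sigma> f = (\<Sum>a\<in>A. single 0 (lookup f a) * monom_eval \<sigma> a)"
  unfolding subst_def using assms by (intro sum.mono_neutral_left) (auto simp: in_keys_iff)

lemma subst_add: "subst \<sigma> (f + g) = subst \<sigma> f + subst \<sigma> g"
proof -
  have s: "keys (f + g) \<subseteq> keys f \<union> keys g" "finite (keys f \<union> keys g)" using keys_add[of f g] by auto
  show ?thesis
    by (simp add: subst_superset[OF s(2) s(1)] subst_superset[OF s(2), of f] subst_superset[OF s(2), of g]
        lookup_add single_add distrib_right sum.distrib)
qed

lemma subst_single: "subst \<sigma> (single a c) = single 0 c * monom_eval \<sigma> a"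
  by (simp add: subst_def)

lemma subst_0 [simp]: "subst \<sigma> 0 = 0" by (simp add: subst_def)

lemma subst_sum: "subst \<sigma> (sum f A) = (\<Sum>i\<in>A. subst \<sigma> (f i))"
  by (induction A rule: infinite_finite_induct) (simp_all add: subst_add)

lemma subst_mult:
  fixes f g :: "('a::finite, 'b::field) mpoly"
  shows "subst \<sigma> (f * g) = subst \<sigma> f * subst \<sigma> g"
proof -
  have "f * g = (\<Sum>a\<in>keys f. single a (lookup f a)) * (\<Sum>b\<in>keys g. single b (lookup g b))"
    by (simp only: sum_single_lookup)
  then have "subst \<sigma> (f * g)
      = (\<Sum>a\<in>keys f. \<Sum>b\<in>keys g. subst \<sigma> (single (a + b) (lookup f a * lookup g b)))"
    by (simp only: sum_product subst_sum mult_single)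
  moreover have "subst \<sigma> (single (a + b) (c * d))
      = (single 0 c * monom_eval \<sigma> a) * (single 0 d * monom_eval \<sigma> b)" for a b c d
  proof -
    have "single 0 (c * d) = (single 0 c * single 0 d :: ('a, 'b) mpoly)" by (simp add: mult_single)
    then show ?thesis by (simp add: subst_single monom_eval_add ac_simps)
  qed
  ultimately show ?thesis by (simp only: subst_def sum_product)
qed

lemma subst_const: "subst \<sigma> (single 0 c) = single 0 c"
  by (simp add: subst_single)

lemma ideal_cong_prod:
  assumes "is_ideal K" "\<And>i. i \<in> A \<Longrightarrow> x i - y i \<in> K"
  shows "prod x A - prod y A \<in> K"
  using assms(2)
proof (induction A rule: infinite_finite_induct)
  case (insert i A)
  have "prod x (insert i A) - prod y (insert i A) = x i * (prod x A - prod y A) + (x i - y i) * prod y A"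
    using insert.hyps by (simp add: algebra_simps)
  also have "\<dots> \<in> K"
    using insert by (intro is_ideal_add[OF assms(1)] is_ideal_mult[OF assms(1)] is_ideal_mult_right[OF assms(1)]) auto
  finally show ?case .
qed (simp_all add: is_ideal_zero[OF assms(1)])

text \<open>Used with \<open>Var\<close> on one side: if every variable is moved by an element of K,
  then every polynomial is.\<close>

lemma subst_cong_ideal:
  assumes K: "is_ideal K" and "\<And>v. \<sigma> v - \<tau> v \<in> K"
  shows "subst \<sigma> f - subst \<tau> f \<in> K"
proof -
  have "\<sigma> v ^ n - \<tau> v ^ n \<in> K" for v n
    using ideal_cong_prod[OF K, of "{..<n}" "\<lambda>_. \<sigma> v" "\<lambda>_. \<tau> v"] assms(2) by simp
  then have "monom_eval \<sigma> a - monom_eval \<tau> a \<in> K" for a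
    unfolding monom_eval_def by (intro ideal_cong_prod[OF K])
  then have "(\<Sum>a\<in>keys f. single 0 (lookup f a) * (monom_eval \<sigma> a - monom_eval \<tau> a)) \<in> K"
    by (intro is_ideal_sum[OF K] is_ideal_mult[OF K])
  then show ?thesis by (simp add: subst_def right_diff_distrib sum_subtractf)
qed

lemma monom_eval_Var: "monom_eval (Var :: 'v::finite \<Rightarrow> ('v, 'k::field) mpoly) a = single a 1"
proof -
  have p: "Var v ^ n = (single (single v n) 1 :: ('v, 'k) mpoly)" for v n
    by (induction n) (simp_all add: Var_def mult_single flip: single_add)
  have "(\<Prod>v\<in>A. single (single v (lookup a v)) 1) = (single (\<Sum>v\<in>A. single v (lookup a v)) 1 :: ('v, 'k) mpoly)"
    if "finite A" for A
    using that by induction (simp_all add: mult_single)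
  then have "monom_eval (Var :: 'v \<Rightarrow> ('v, 'k) mpoly) a = single (\<Sum>v\<in>UNIV. single v (lookup a v)) 1"
    by (simp add: monom_eval_def p)
  moreover have "(\<Sum>v\<in>UNIV. single v (lookup a v)) = a"
    by (rule poly_mapping_eqI) (simp add: lookup_sum lookup_single when_def sum.delta)
  ultimately show ?thesis by simp
qed

lemma subst_Var_id: "subst Var f = f"
  by (simp add: subst_def monom_eval_Var mult_single sum_single_lookup)

section \<open>Linear forms and their elimination\<close>

definition lin :: "('v::finite \<Rightarrow> 'k) \<Rightarrow> ('v, 'k::field) mpoly" where
  "lin c = (\<Sum>v\<in>UNIV. single (single v 1) (c v))"

lemma single_one_eq_iff: "single v (1::nat) = single w 1 \<longleftrightarrow> v = w"
proof
  assume "single v (1::nat) = single w 1"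
  then have "lookup (single w (1::nat)) v = 1" by (metis lookup_single_eq)
  then show "v = w" by (simp add: lookup_single when_def split: if_splits)
qed simp

lemma lookup_lin: "lookup (lin c) (single v 1) = c v"
proof -
  have "lookup (lin c) (single v 1) = (\<Sum>w\<in>UNIV. if w = v then c w else 0)"
    unfolding lin_def lookup_sum 
    by (intro sum.cong refl) (simp add: lookup_single when_def single_one_eq_iff del: One_nat_def)
  then show ?thesis by simp
qed

lemma keys_lin: "keys (lin c) = (\<lambda>v. single v 1) ` {v. c v \<noteq> 0}"
proof
  show "keys (lin c) \<subseteq> (\<lambda>v. single v 1) ` {v. c v \<noteq> 0}"
    unfolding lin_def using keys_sum[of "\<lambda>v. single (single v 1) (c v)" UNIV]
    by (auto simp del: One_nat_def split: if_splits)
  show "(\<lambda>v. single v 1) ` {v. c v \<noteq> 0} \<subseteq> keys (lin c)"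
    using lookup_lin[of c] by (auto simp: in_keys_iff)
qed

lemma lin_eq_0_iff: "lin c = 0 \<longleftrightarrow> (\<forall>v. c v = 0)"
  using keys_lin[of c] keys_eq_empty[of "lin c"] by auto

lemma lin_diff_scale: "lin (\<lambda>v. b v - t * c v) = lin b - single 0 t * lin c"
  by (simp add: lin_def sum_distrib_left mult_single single_diff sum_subtractf)

lemma lin_in_cover_prime: "lin c \<in> cover_prime W \<longleftrightarrow> (\<forall>v. v \<notin> W \<longrightarrow> c v = 0)"
  by (auto simp: cover_prime_def mideal_def keys_lin cdeg_single)

lemma subst_lin: "subst \<sigma> (lin c) = (\<Sum>v\<in>UNIV. single 0 (c v) * \<sigma> v)"
  by (simp add: lin_def subst_sum subst_single monom_eval_single[simplified])

text \<open>\<open>J\<close> is generated by linear forms and \<open>\<phi>\<close> solves these for some of the variables.\<close>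

definition linear_elim :: "(('v::finite, 'k::field) mpoly \<Rightarrow> ('v, 'k) mpoly) \<Rightarrow> ('v, 'k) mpoly set \<Rightarrow> bool" where
  "linear_elim \<phi> J \<longleftrightarrow> (\<forall>f g. \<phi> (f + g) = \<phi> f + \<phi> g) \<and> (\<forall>f g. \<phi> (f * g) = \<phi> f * \<phi> g) \<and>
     (\<forall>c. \<phi> (single 0 c) = single 0 c) \<and> (\<forall>f. \<phi> f = 0 \<longleftrightarrow> f \<in> J) \<and> (\<forall>f. f - \<phi> f \<in> J) \<and>
     (\<forall>c. \<exists>c'. \<phi> (lin c) = lin c')"

lemma linear_elim_cover_prime:
  "linear_elim (subst (\<lambda>v. if v \<in> W then 0 else Var v))
    (cover_prime W :: ('v::finite, 'k::field) mpoly set)"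
proof -
  let ?\<sigma> = "\<lambda>v. if v \<in> W then 0 else (Var v :: ('v, 'k) mpoly)"
  have "subst Var f - subst ?\<sigma> f \<in> cover_prime W" for f
    by (rule subst_cong_ideal[OF is_ideal_cover_prime]) (simp add: is_ideal_zero[OF is_ideal_cover_prime])
  then have diff: "f - subst ?\<sigma> f \<in> cover_prime W" for f :: "('v, 'k) mpoly" by (simp add: subst_Var_id)
  have "subst ?\<sigma> f = 0" if "f \<in> cover_prime W" for f
    unfolding subst_def
  proof (rule sum.neutral, rule ballI)
    fix a assume "a \<in> keys f"
    then have "0 < cdeg W a" using that by (auto simp: cover_prime_def mideal_def)
    then obtain v b where "v \<in> W" "a = single v 1 + b" by (rule cdeg_pos_split)
    then have "monom_eval ?\<sigma> a = 0" by (simp add: monom_eval_add monom_eval_single[simplified])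
    then show "single 0 (lookup f a) * monom_eval ?\<sigma> a = 0" by simp
  qed
  moreover have "f \<in> cover_prime W" if "subst ?\<sigma> f = 0" for f using diff[of f] that by simp
  moreover have "subst ?\<sigma> (lin c) = lin (\<lambda>v. if v \<in> W then 0 else c v)" for c
    unfolding subst_lin unfolding lin_def by (intro sum.cong) (auto simp: Var_def mult_single)
  ultimately show ?thesis
    unfolding linear_elim_def using diff by (auto simp: subst_add subst_mult subst_const)
qed

text \<open>One step of Gaussian elimination. Modulo J the form \<open>lin c\<close> becomes a
  nonzero form \<open>lin e\<close>, and solving it for a pivot variable gives the new map. The
  second conclusion lets linear independence modulo J descend to the extended ideal.\<close>

lemma linear_elim_step:
  fixes J :: "('v::finite, 'k::field) mpoly set"
  assumes \<phi>: "linear_elim \<phi> J" and c: "lin c \<notin> J"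
  obtains \<psi> where "linear_elim \<psi> (extend J (lin c))"
    "\<And>b. lin b \<in> extend J (lin c) \<Longrightarrow> \<exists>t. lin (\<lambda>v. b v - t * c v) \<in> J"
proof -
  have add: "\<And>f g. \<phi> (f + g) = \<phi> f + \<phi> g" and mult: "\<And>f g. \<phi> (f * g) = \<phi> f * \<phi> g"
   and const: "\<And>c. \<phi> (single 0 c) = single 0 c" and ker: "\<And>f. f \<in> J \<longleftrightarrow> \<phi> f = 0"
   and id: "\<And>f. f - \<phi> f \<in> J" and \<phi>lin: "\<And>c. \<exists>c'. \<phi> (lin c) = lin c'"
    using \<phi> unfolding linear_elim_def by blast+
  have zero: "\<phi> 0 = 0" using const[of 0] by simp
  have diff: "\<phi> (f - g) = \<phi> f - \<phi> g" for f g using add[of "f - g" g] by simp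
  have J: "is_ideal J" by (rule is_idealI) (simp_all add: ker zero add mult)
  obtain e where e: "\<phi> (lin c) = lin e" using \<phi>lin by blast
  then have "lin e \<noteq> 0" using c ker by auto
  then obtain p where p: "e p \<noteq> 0" by (auto simp: lin_eq_0_iff)
  \<comment> \<open>The pivot variable is replaced by its solution from \<open>lin e = 0\<close>;
    the result no longer involves the variable p, and \<open>lin e\<close> is sent to 0.\<close>
  define \<sigma> where "\<sigma> v = (if v = p then Var p - single 0 (1 / e p) * lin e else Var v)" for v
  let ?\<chi> = "subst \<sigma>"
  have \<chi>lin: "?\<chi> (lin b) = lin (\<lambda>v. b v - (b p / e p) * e v)" for b
  proof -
    have "?\<chi> (lin b) = (\<Sum>v\<in>UNIV. single (single v 1) (b v) - (if v = p then single 0 (b p / e p) * lin e else 0))"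
      unfolding subst_lin
      by (intro sum.cong refl)
         (auto simp: \<sigma>_def right_diff_distrib Var_def mult_single simp flip: mult.assoc)
    also have "\<dots> = lin b - single 0 (b p / e p) * lin e"
      by (simp add: sum_subtractf lin_def)
    finally show ?thesis by (simp only: lin_diff_scale)
  qed
  let ?K = "range (\<lambda>h. lin e * h)"
  have K: "is_ideal ?K"
  proof (rule is_idealI)
    show "0 \<in> ?K" by (rule range_eqI[of _ _ 0]) simp
    show "a + b \<in> ?K" if "a \<in> ?K" "b \<in> ?K" for a b
      using that by (auto simp flip: distrib_left)
    show "r * a \<in> ?K" if "a \<in> ?K" for a r
      using that by (auto simp: mult.left_commute[of r])
  qed
  have "Var v - \<sigma> v = lin e * (if v = p then single 0 (1 / e p) else 0)" for v
    by (simp add: \<sigma>_def)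
  then have "Var v - \<sigma> v \<in> ?K" for v by blast
  then have "subst Var f - ?\<chi> f \<in> ?K" for f by (rule subst_cong_ideal[OF K])
  then have \<chi>id: "\<exists>h. f - ?\<chi> f = lin e * h" for f by (auto simp: subst_Var_id image_iff)
  have ex: "f - ?\<chi> (\<phi> f) \<in> extend J (lin c)" for f
  proof -
    obtain h where h: "\<phi> f - ?\<chi> (\<phi> f) = lin e * h" using \<chi>id by blast
    have "f - ?\<chi> (\<phi> f) = (f - \<phi> f) + lin e * h" using h by (simp add: algebra_simps)
    also have "\<dots> = ((f - \<phi> f) - (lin c - \<phi> (lin c)) * h) + lin c * h"
      by (simp add: e algebra_simps)
    finally show ?thesis
      by (rule extendI[rotated]) (intro is_ideal_diff[OF J] is_ideal_mult_right[OF J] id)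
  qed
  have \<chi>e: "?\<chi> (lin e) = 0" using p by (simp add: \<chi>lin lin_eq_0_iff)
  have ker': "?\<chi> (\<phi> f) = 0 \<longleftrightarrow> f \<in> extend J (lin c)" for f
  proof
    assume "?\<chi> (\<phi> f) = 0" then show "f \<in> extend J (lin c)" using ex[of f] by simp
  next
    assume "f \<in> extend J (lin c)"
    then obtain j h where "f = j + lin c * h" "j \<in> J" by (rule extendE)
    then show "?\<chi> (\<phi> f) = 0" by (simp add: add mult ker e subst_mult \<chi>e)
  qed
  show thesis
  proof (rule that[of "?\<chi> \<circ> \<phi>"])
    show "linear_elim (?\<chi> \<circ> \<phi>) (extend J (lin c))"
      unfolding linear_elim_def
    proof (intro conjI allI)
      fix b
      obtain b' where "\<phi> (lin b) = lin b'" using \<phi>lin by blast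
      then show "\<exists>c'. (?\<chi> \<circ> \<phi>) (lin b) = lin c'" by (auto simp: \<chi>lin)
    qed (simp_all add: add mult const subst_add subst_mult subst_const ker' ex)
    fix b assume b: "lin b \<in> extend J (lin c)"
    obtain b' where b': "\<phi> (lin b) = lin b'" using \<phi>lin by blast
    \<comment> \<open>This multiple of e cancels the coefficient of the pivot in b'.\<close>
    let ?t = "b' p / e p"
    have "\<phi> (lin (\<lambda>v. b v - ?t * c v)) = lin (\<lambda>v. b' v - ?t * e v)"
      by (simp only: lin_diff_scale diff mult const b' e)
    also have "\<dots> = 0" using ker'[of "lin b"] b by (simp add: b' \<chi>lin)
    finally show "\<exists>t. lin (\<lambda>v. b v - t * c v) \<in> J" unfolding ker by blast
  qed
qed

text \<open>The map \<phi> embeds S/J into the polynomial ring, so S/J is a domain and any linear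
  form outside J is a non-zero-divisor. A relation among the later forms modulo (J, c) becomes a
  relation modulo J with the extra coefficient -t at c.\<close>

lemma wreg_linear:
  fixes J :: "('v::finite, 'k::field) mpoly set"
  assumes "linear_elim \<phi> J"
    and "\<And>b. lin (\<lambda>v. \<Sum>i<length cs. b i * (cs ! i) v) \<in> J \<Longrightarrow> \<forall>i<length cs. b i = 0"
  shows "wreg J (map lin cs)"
  using assms
proof (induction cs arbitrary: \<phi> J)
  case (Cons c cs)
  have split: "(\<Sum>i<length (c # cs). b i * ((c # cs) ! i) v) = b 0 * c v + (\<Sum>i<length cs. b (Suc i) * (cs ! i) v)"
    for b :: "nat \<Rightarrow> 'k" and v
    unfolding length_Cons sum.lessThan_Suc_shift by simp
  have c: "lin c \<notin> J"
  proof
    assume "lin c \<in> J"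
    then have "lin (\<lambda>v. \<Sum>i<length (c # cs). (if i = 0 then 1 else 0) * ((c # cs) ! i) v) \<in> J"
      unfolding split by simp
    from Cons.prems(2)[OF this] show False by auto
  qed
  have "f \<in> J" if "lin c * f \<in> J" for f
    using that c Cons.prems(1) mpoly_mult_eq_0[of "\<phi> (lin c)" "\<phi> f"] unfolding linear_elim_def by metis
  moreover have "wreg (extend J (lin c)) (map lin cs)"
  proof -
    obtain \<psi> where \<psi>: "linear_elim \<psi> (extend J (lin c))"
      "\<And>b. lin b \<in> extend J (lin c) \<Longrightarrow> \<exists>t. lin (\<lambda>v. b v - t * c v) \<in> J"
      using linear_elim_step[OF Cons.prems(1) c] by blast
    show ?thesis
    proof (rule Cons.IH[OF \<psi>(1)])
      fix b assume "lin (\<lambda>v. \<Sum>i<length cs. b i * (cs ! i) v) \<in> extend J (lin c)"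
      then obtain t where "lin (\<lambda>v. (\<Sum>i<length cs. b i * (cs ! i) v) - t * c v) \<in> J"
        using \<psi>(2) by blast
      then have "lin (\<lambda>v. \<Sum>i<length (c # cs). (case i of 0 \<Rightarrow> - t | Suc i \<Rightarrow> b i) * ((c # cs) ! i) v) \<in> J"
        unfolding split by (simp add: algebra_simps)
      from Cons.prems(2)[OF this] show "\<forall>i<length cs. b i = 0" by force
    qed
  qed
  ultimately show ?case by simp
qed simp

definition star_seq :: "(nat \<Rightarrow> 'v::finite set) \<Rightarrow> nat \<Rightarrow> ('v, 'k::field) mpoly list" where
  "star_seq A r = map (\<lambda>i. lin (\<lambda>v. of_bool (v \<in> A i) - of_bool (v \<in> A r))) [0..<r]"

text \<open>Modulo the variables in \<open>W\<close>, at most one of the sums \<open>\<Sum>A\<^sub>i\<close> vanishes. It may be any of them; this is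
  why differences are used, at the cost of one element.\<close>

lemma wreg_star_seq_cover_prime:
  assumes dis: "\<And>i k. i \<le> r \<Longrightarrow> k \<le> r \<Longrightarrow> i \<noteq> k \<Longrightarrow> A i \<inter> A k = {}"
    and W: "\<And>i. i \<le> r \<Longrightarrow> i \<noteq> j \<Longrightarrow> \<not> A i \<subseteq> W"
  shows "wreg (cover_prime W :: ('v::finite, 'k::field) mpoly set) (star_seq A r)"
proof -
  define cs where "cs = map (\<lambda>i v. of_bool (v \<in> A i) - of_bool (v \<in> A r) :: 'k) [0..<r]"
  have "wreg (cover_prime W) (map lin cs)"
  proof (rule wreg_linear[OF linear_elim_cover_prime])
    fix b assume "lin (\<lambda>v. \<Sum>i<length cs. b i * (cs ! i) v) \<in> cover_prime W"
    then have z: "(\<Sum>i<r. b i * (of_bool (v \<in> A i) - of_bool (v \<in> A r))) = 0" if "v \<notin> W" for v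
      using that by (simp add: lin_in_cover_prime cs_def)
    have b0: "b k = 0" if k: "k < r" "k \<noteq> j" for k
    proof -
      obtain v where v: "v \<in> A k" "v \<notin> W" using W[of k] k by auto
      have "v \<in> A i \<longleftrightarrow> i = k" if "i \<le> r" for i using dis[of i k] v k that by auto
      then have "(\<Sum>i<r. b i * (of_bool (v \<in> A i) - of_bool (v \<in> A r))) = (\<Sum>i<r. if i = k then b i else 0)"
        using k by (intro sum.cong) auto
      then show ?thesis using z[OF v(2)] k by simp
    qed
    \<comment> \<open>A_j may lie in W, so the last coefficient is read off at a vertex of A_r
      outside W, where every difference takes the value -1.\<close>
    moreover have "b j = 0" if j: "j < r"
    proof -
      obtain v where v: "v \<in> A r" "v \<notin> W" using W[of r] j by auto
      have "v \<in> A i \<longleftrightarrow> i = r" if "i \<le> r" for i using dis[of i r] v that by auto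
      then have "(\<Sum>i<r. b i * (of_bool (v \<in> A i) - of_bool (v \<in> A r))) = (\<Sum>i<r. if i = j then - b i else 0)"
        using b0 by (intro sum.cong) auto
      then show ?thesis using z[OF v(2)] j by simp
    qed
    ultimately show "\<forall>i<length cs. b i = 0" by (auto simp: cs_def)
  qed
  then show ?thesis by (simp add: star_seq_def cs_def comp_def)
qed

section \<open>Graphs with loops\<close>

text \<open>A symmetric relation \<open>h\<close> encodes an edge ideal together with a set of variables: a loop at \<open>a\<close> stands
  for the generator \<open>x\<^sub>a\<close>, that is, for the deletion of the vertex \<open>a\<close>.\<close>

definition edge_exponents :: "('v \<Rightarrow> 'v \<Rightarrow> bool) \<Rightarrow> ('v \<Rightarrow>\<^sub>0 nat) set" where
  "edge_exponents h = {n. \<exists>a b. h a b \<and> 0 < lookup n a \<and> 0 < lookup n b}"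

definition del :: "('v \<Rightarrow> 'v \<Rightarrow> bool) \<Rightarrow> 'v \<Rightarrow> 'v \<Rightarrow> 'v \<Rightarrow> bool" where
  "del h v a b \<longleftrightarrow> h a b \<or> a = v \<and> b = v"

definition col :: "('v \<Rightarrow> 'v \<Rightarrow> bool) \<Rightarrow> 'v \<Rightarrow> 'v \<Rightarrow> 'v \<Rightarrow> bool" where
  "col h v a b \<longleftrightarrow> h a b \<or> a = b \<and> h a v"

lemma upset_edge_exponents: "upset (edge_exponents h)"
  unfolding upset_def edge_exponents_def by (auto simp: lookup_add)

lemma edge_exponents_del:
  "edge_exponents (del h v) = edge_exponents h \<union> range ((+) (single v 1))"
proof -
  have "n \<in> range ((+) (single v 1)) \<longleftrightarrow> 0 < lookup n v" for n :: "'a \<Rightarrow>\<^sub>0 nat"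
    unfolding range_plus by (auto simp: lookup_single when_def)
  then show ?thesis unfolding edge_exponents_def del_def by blast
qed

lemma lookup_single_add_pos: "0 < lookup (single v (1::nat) + n) a \<longleftrightarrow> a = v \<or> 0 < lookup n a"
  by (auto simp: lookup_add lookup_single when_def)

text \<open>Dividing the edge generator of v and a by x_v leaves x_a, a loop at a. A loop at v
  itself would make the colon the whole ring, which no relation encodes.\<close>

lemma edge_exponents_col:
  assumes "symp h" "\<not> h v v"
  shows "{n. single v 1 + n \<in> edge_exponents h} = edge_exponents (col h v)"
proof -
  have sym: "h b a" if "h a b" for a b using assms(1) that by (rule sympD)
  show ?thesis
    unfolding edge_exponents_def col_def mem_Collect_eq lookup_single_add_pos
    using assms(2) by (intro Collect_cong) (metis sym)
qed

lemma wreg_edge_exponents_step: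
  fixes gs :: "('v::finite, 'k::field) mpoly list"
  assumes "symp h" "\<not> h v v" "wreg (mideal (edge_exponents (del h v))) gs"
    "wreg (mideal (edge_exponents (col h v))) gs"
  shows "wreg (mideal (edge_exponents h)) gs"
proof (rule wreg_mideal_filtration[OF upset_edge_exponents])
  show "wreg (mideal {n. single v 1 + n \<in> edge_exponents h}) gs"
    unfolding edge_exponents_col[OF assms(1,2)] by (rule assms(4))
  show "wreg (mideal (edge_exponents h \<union> range ((+) (single v 1)))) gs"
    unfolding edge_exponents_del[symmetric] by (rule assms(3))
qed

lemma symp_del: "symp h \<Longrightarrow> symp (del h v)"
  unfolding symp_def del_def by blast

lemma symp_col: "symp h \<Longrightarrow> symp (col h v)"
  unfolding symp_def col_def by blast

text \<open>The invariant of the reductions. Vertices with a loop count as deleted, so only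
  neighbours without a loop have to stay in A. When no edge between remaining vertices is left, c
  witnesses that A is not contained in the set of deleted variables.\<close>

definition centre :: "('v \<Rightarrow> 'v \<Rightarrow> bool) \<Rightarrow> 'v set \<Rightarrow> 'v \<Rightarrow> bool" where
  "centre h A c \<longleftrightarrow> c \<in> A \<and> \<not> h c c \<and> (\<forall>b. h c b \<longrightarrow> \<not> h b b \<longrightarrow> b \<in> A)"

lemma centre_del: "centre h A c \<Longrightarrow> c \<noteq> v \<Longrightarrow> centre (del h v) A c"
  by (auto simp: centre_def del_def)

lemma centre_col_self:
  assumes "symp h" "\<not> h v v" "v \<in> A" shows "centre (col h v) A v"
  unfolding centre_def
proof (intro conjI allI impI)
  show "\<not> col h v v v" using assms(2) by (simp add: col_def)
  fix b assume b: "col h v v b" "\<not> col h v b b"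
  then have "h v b" using assms(2) by (auto simp: col_def)
  then have "h b v" using assms(1) by (auto dest: sympD)
  then show "b \<in> A" using b(2) by (simp add: col_def)
qed (rule assms(3))

text \<open>The colon by v deletes all neighbours of v. If v lies in A, then v becomes isolated and
  takes over as centre; otherwise c is not adjacent to v and stays.\<close>

lemma centre_col:
  assumes "symp h" "\<not> h v v" "centre h A c" shows "\<exists>c'. centre (col h v) A c'"
proof (cases "v \<in> A")
  case True then show ?thesis using centre_col_self[of h v A, OF assms(1,2)] by (intro exI)
next
  case False
  then have "centre (col h v) A c" using assms unfolding centre_def col_def by blast
  then show ?thesis ..
qed

lemma card_alive_del: "\<not> h v v \<Longrightarrow> card {a. \<not> del h v a a} < card {a::'v::finite. \<not> h a a}"
  by (rule psubset_card_mono) (auto simp: del_def)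

lemma card_alive_col:
  "h u v \<Longrightarrow> \<not> h u u \<Longrightarrow> card {a. \<not> col h v a a} < card {a::'v::finite. \<not> h a a}"
  by (rule psubset_card_mono) (auto simp: col_def)

text \<open>Each step deletes at least one vertex: v itself, or a neighbour of v through the colon.
  The index j marks the one star allowed to have no centre.\<close>

lemma wreg_edge_exponents:
  fixes h :: "'v::finite \<Rightarrow> 'v \<Rightarrow> bool"
  assumes dis: "\<And>i k. i \<le> r \<Longrightarrow> k \<le> r \<Longrightarrow> i \<noteq> k \<Longrightarrow> A i \<inter> A k = {}"
    and "symp h" and "\<And>i. i \<le> r \<Longrightarrow> i \<noteq> j \<Longrightarrow> \<exists>c. centre h (A i) c"
  shows "wreg (mideal (edge_exponents h) :: ('v, 'k::field) mpoly set) (star_seq A r)"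
  using assms(2,3)
proof (induction "card {a. \<not> h a a}" arbitrary: h rule: less_induct)
  case less
  note sym = less.prems(1)
  obtain c where c: "\<And>i. i \<le> r \<Longrightarrow> i \<noteq> j \<Longrightarrow> centre h (A i) (c i)" using less.prems(2) by metis
  show ?case
  proof (cases "\<exists>a b. h a b \<and> \<not> h a a \<and> \<not> h b b")
    case False
    have "edge_exponents h = {n. 1 \<le> cdeg {w. h w w} n}"
    proof safe
      fix n assume "n \<in> edge_exponents h"
      then obtain a where "h a a" "0 < lookup n a" using False by (auto simp: edge_exponents_def)
      then show "1 \<le> cdeg {w. h w w} n"
        using member_le_sum[of a "{w. h w w}" "lookup n"] by (simp add: cdeg_def)
    next
      fix n assume "1 \<le> cdeg {w. h w w} n"
      then have "0 < cdeg {w. h w w} n" by simp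
      then obtain v b where "h v v" "n = single v 1 + b" by (auto elim: cdeg_pos_split)
      then show "n \<in> edge_exponents h" unfolding edge_exponents_def using lookup_single_add_pos[of v b v] by blast
    qed
    then have e: "mideal (edge_exponents h) = (cover_prime {w. h w w} :: ('v, 'k) mpoly set)"
      by (simp add: cover_prime_def)
    show ?thesis
      unfolding e
    proof (rule wreg_star_seq_cover_prime[OF dis])
      show "\<not> A i \<subseteq> {w. h w w}" if "i \<le> r" "i \<noteq> j" for i using c[OF that] by (auto simp: centre_def)
    qed
  next
    case True
    then obtain a b where ab: "h a b" "\<not> h a a" "\<not> h b b" by blast
    have ba: "h b a" using sym ab(1) by (rule sympD)
    \<comment> \<open>Every remaining edge has an end that is not a chosen centre: if a is the
      centre of A_i, then b lies in A_i, hence differs from a and from the centres of the other,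
      disjoint sets. Deleting such an end keeps all centres.\<close>
    have "\<exists>v u. h u v \<and> \<not> h v v \<and> \<not> h u u \<and> (\<forall>i\<le>r. i \<noteq> j \<longrightarrow> c i \<noteq> v)"
    proof (cases "\<exists>i\<le>r. i \<noteq> j \<and> c i = a")
      case True
      then obtain i where i: "i \<le> r" "i \<noteq> j" "c i = a" by blast
      have "b \<in> A i" using c[OF i(1,2)] i(3) ab by (auto simp: centre_def)
      then have "c k \<noteq> b" if "k \<le> r" "k \<noteq> j" for k
        using c[OF that] dis[OF that(1) i(1)] i(3) ab by (cases "k = i") (auto simp: centre_def)
      then show ?thesis using ab by blast
    next
      case False
      then show ?thesis using ab ba by blast
    qed
    then obtain v u where uv: "h u v" "\<not> h v v" "\<not> h u u" "\<And>i. i \<le> r \<Longrightarrow> i \<noteq> j \<Longrightarrow> c i \<noteq> v" by blast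
    show ?thesis
    proof (rule wreg_edge_exponents_step[OF sym uv(2)])
      show "wreg (mideal (edge_exponents (del h v)) :: ('v, 'k) mpoly set) (star_seq A r)"
      proof (rule less.hyps[OF card_alive_del[of h, OF uv(2)] symp_del[OF sym]])
        show "\<exists>c. centre (del h v) (A i) c" if "i \<le> r" "i \<noteq> j" for i
          using centre_del[OF c[OF that] uv(4)[OF that]] by (rule exI)
      qed
      show "wreg (mideal (edge_exponents (col h v)) :: ('v, 'k) mpoly set) (star_seq A r)"
      proof (rule less.hyps[OF card_alive_col[of h, OF uv(1,3)] symp_col[OF sym]])
        show "\<exists>c. centre (col h v) (A i) c" if "i \<le> r" "i \<noteq> j" for i
          using centre_col[OF sym uv(2) c[OF that]] .
      qed
    qed
  qed
qed

text \<open>Two of the stars may have lost their centres, but the neighbourhoods of \<open>x\<close> and \<open>y\<close> are completely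
  joined: as soon as a neighbour of \<open>x\<close> is inverted, \<open>y\<close> becomes isolated, and conversely.\<close>

lemma wreg_edge_exponents_joined:
  fixes h :: "'v::finite \<Rightarrow> 'v \<Rightarrow> bool"
  assumes dis: "\<And>i k. i \<le> r \<Longrightarrow> k \<le> r \<Longrightarrow> i \<noteq> k \<Longrightarrow> A i \<inter> A k = {}"
    and pq: "p \<le> r" "q \<le> r" "p \<noteq> q" and xy: "x \<in> A p" "y \<in> A q"
    and "symp h" "\<not> h x x" "\<not> h y y"
    and "\<And>a b. h a x \<Longrightarrow> h b y \<Longrightarrow> h a b"
    and "\<And>i. i \<le> r \<Longrightarrow> i \<noteq> p \<Longrightarrow> i \<noteq> q \<Longrightarrow> \<exists>c. centre h (A i) c"
  shows "wreg (mideal (edge_exponents h) :: ('v, 'k::field) mpoly set) (star_seq A r)"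
  using assms(7-)
proof (induction "card {a. \<not> h a a}" arbitrary: h rule: less_induct)
  case less
  note sym = less.prems(1) and x = less.prems(2) and y = less.prems(3) and join = less.prems(4)
    and cen = less.prems(5)
  have symD: "h b a" if "h a b" for a b using sym that by (rule sympD)
  have notin: "x \<notin> A i" "y \<notin> A i" if "i \<le> r" "i \<noteq> p" "i \<noteq> q" for i
    using dis[of i p] dis[of i q] that pq xy by auto
  show ?case
  proof (cases "\<exists>w. \<not> h w w \<and> w \<noteq> x \<and> w \<noteq> y \<and> (h w x \<or> h w y)")
    case True
    then obtain w where w: "\<not> h w w" "w \<noteq> x" "w \<noteq> y" "h w x \<or> h w y" by blast
    show ?thesis
    proof (rule wreg_edge_exponents_step[OF sym w(1)])
      show "wreg (mideal (edge_exponents (del h w)) :: ('v, 'k) mpoly set) (star_seq A r)"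
      proof (rule less.hyps[OF card_alive_del[of h, OF w(1)] symp_del[OF sym]])
        show "\<exists>c. centre (del h w) (A i) c" if i: "i \<le> r" "i \<noteq> p" "i \<noteq> q" for i
        proof -
          obtain c where c: "centre h (A i) c" using cen[OF i] by blast
          \<comment> \<open>The remaining vertex x or y is a neighbour of w outside
            \<open>A i\<close>, so w cannot be a centre there.\<close>
          then have "c \<noteq> w" using notin[OF i] w(4) x y by (auto simp: centre_def)
          then show ?thesis using centre_del[OF c] by blast
        qed
      qed (use x y w join in \<open>auto simp: del_def\<close>)
      have "\<not> (h w x \<and> h w y)" using join[of w w] w(1) by blast
      then consider "h w x" "\<not> h w y" | "h w y" "\<not> h w x" using w(4) by blast
      then show "wreg (mideal (edge_exponents (col h w)) :: ('v, 'k) mpoly set) (star_seq A r)"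
      proof cases
        case 1
        \<comment> \<open>All neighbours of y are joined to w, so the colon by w deletes them and
          leaves y isolated. It also deletes x, so from here on p is the exempt index.\<close>
        have "h b w" if "h y b" for b using join[OF 1(1) symD[OF that]] by (rule symD)
        moreover have "\<not> h y w" using 1(2) symD by blast
        ultimately have c: "centre (col h w) (A q) y"
          using xy y by (auto simp: centre_def col_def)
        show ?thesis
        proof (rule wreg_edge_exponents[OF dis symp_col[OF sym]])
          show "\<exists>c. centre (col h w) (A i) c" if "i \<le> r" "i \<noteq> p" for i
            using c cen[OF that] centre_col[OF sym w(1)] by (cases "i = q") auto
        qed
      next
        case 2
        have "h b w" if "h x b" for b using join[OF symD[OF that] 2(1)] .
        moreover have "\<not> h x w" using 2(2) symD by blast
        ultimately have c: "centre (col h w) (A p) x"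
          using xy x by (auto simp: centre_def col_def)
        show ?thesis
        proof (rule wreg_edge_exponents[OF dis symp_col[OF sym]])
          show "\<exists>c. centre (col h w) (A i) c" if "i \<le> r" "i \<noteq> q" for i
            using c cen[OF that(1) _ that(2)] centre_col[OF sym w(1)] by (cases "i = p") auto
        qed
      qed
    qed
  next
    case False
    show ?thesis
    proof (rule wreg_edge_exponents_step[OF sym y])
      have "x \<noteq> y" using dis[OF pq] xy by blast
      \<comment> \<open>Only y can still be a remaining neighbour of x. Deleting y isolates x and
        saves A_p; the colon by y isolates y and saves A_q.\<close>
      have "b = y \<or> h b b" if "h x b" for b
      proof (rule ccontr)
        assume "\<not> ?thesis"
        moreover then have "b \<noteq> x" using that x by auto
        ultimately show False using False symD[OF that] by blast
      qed
      then have c: "centre (del h y) (A p) x"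
        using \<open>x \<noteq> y\<close> xy x by (auto simp: centre_def del_def)
      show "wreg (mideal (edge_exponents (del h y)) :: ('v, 'k) mpoly set) (star_seq A r)"
      proof (rule wreg_edge_exponents[OF dis symp_del[OF sym]])
        show "\<exists>c. centre (del h y) (A i) c" if i: "i \<le> r" "i \<noteq> q" for i
        proof (cases "i = p")
          case False
          obtain c' where c': "centre h (A i) c'" using cen[OF i(1) False i(2)] by blast
          then have "c' \<noteq> y" using notin[OF i(1) False i(2)] by (auto simp: centre_def)
          then show ?thesis using centre_del[OF c'] by blast
        qed (use c in blast)
      qed
      have c: "centre (col h y) (A q) y" by (rule centre_col_self[of h, OF sym y xy(2)])
      show "wreg (mideal (edge_exponents (col h y)) :: ('v, 'k) mpoly set) (star_seq A r)"
      proof (rule wreg_edge_exponents[OF dis symp_col[OF sym]])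
        show "\<exists>c. centre (col h y) (A i) c" if "i \<le> r" "i \<noteq> p" for i
          using c cen[OF that] centre_col[OF sym y] by (cases "i = q") auto
      qed
    qed
  qed
qed

section \<open>Adding the edges to the second symbolic power\<close>

abbreviation adj :: "'v set set \<Rightarrow> 'v \<Rightarrow> 'v \<Rightarrow> bool" where
  "adj E a b \<equiv> {a, b} \<in> E"

lemma adj_commute: "adj E a b \<longleftrightarrow> adj E b a"
  by (simp add: insert_commute)

lemma adj_irrefl: "simple_graph E \<Longrightarrow> \<not> adj E a a"
  by (auto simp: simple_graph_def)

lemma vertex_cover_Compl:
  assumes "\<And>a b. a \<in> T \<Longrightarrow> b \<in> T \<Longrightarrow> \<not> adj E a b" shows "vertex_cover E (- T)"
  using assms by (auto simp: vertex_cover_def)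

definition edge_added :: "'v::finite set set \<Rightarrow> 'v set set \<Rightarrow> ('v \<Rightarrow>\<^sub>0 nat) set" where
  "edge_added E F = symbolic_exponents E \<union> edge_exponents (adj F)"

text \<open>The case a = b of the joining puts a loop at each common neighbour of x and y: a
  triangle on x, y, a gives an element of the second symbolic power. The last clause comes from an
  added generator ax or ay, which leaves x_a after division by xy.\<close>

definition colon_graph :: "'v set set \<Rightarrow> 'v set set \<Rightarrow> 'v \<Rightarrow> 'v \<Rightarrow> 'v \<Rightarrow> 'v \<Rightarrow> bool" where
  "colon_graph E F x y a b \<longleftrightarrow> adj E a b \<or> (adj E a x \<and> adj E b y) \<or> (adj E a y \<and> adj E b x)
     \<or> (a = b \<and> (adj F a x \<or> adj F a y))"

lemma upset_symbolic_exponents: "upset (symbolic_exponents E)"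
  by (auto simp: upset_def symbolic_exponents_def cdeg_add trans_le_add2)

lemma cdeg_ge: "v \<in> C \<Longrightarrow> lookup n v \<le> cdeg C n"
  unfolding cdeg_def by (rule member_le_sum) auto

text \<open>A cover containing only one of x and y needs one more factor from n. If the support of n
  is independent and x has no neighbour in it, adding x keeps it independent, and the complement is
  a cover of degree at most 1. So x and y both have neighbours in the support, and these are
  joined.\<close>

lemma symbolic_exponents_colon:
  fixes E :: "'v::finite set set"
  assumes E: "simple_graph E" and xy: "adj E x y"
  shows "single x 1 + single y 1 + n \<in> symbolic_exponents E
    \<longleftrightarrow> n \<in> edge_exponents (colon_graph E {} x y)"
proof
  have deg: "cdeg C (single x 1 + single y 1 + n) = of_bool (x \<in> C) + of_bool (y \<in> C) + cdeg C n" for C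
    by (simp add: cdeg_add cdeg_single)
  {
    assume n: "n \<in> edge_exponents (colon_graph E {} x y)"
    then obtain a b where ab: "0 < lookup n a" "0 < lookup n b" "colon_graph E {} x y a b"
      by (auto simp: edge_exponents_def)
    show "single x 1 + single y 1 + n \<in> symbolic_exponents E"
      unfolding symbolic_exponents_def
    proof (intro CollectI allI impI)
      fix C assume C: "vertex_cover E C"
      have cov: "u \<in> C \<or> v \<in> C" if "adj E u v" for u v using C that by (auto simp: vertex_cover_def)
      have pos: "a \<in> C \<Longrightarrow> 0 < cdeg C n" "b \<in> C \<Longrightarrow> 0 < cdeg C n"
        using ab(1,2) cdeg_ge[of _ C n] by (metis less_le_trans)+
      have "x \<in> C \<and> y \<in> C \<or> 0 < cdeg C n"
        using ab(3) cov[of a b] cov[of a x] cov[of a y] cov[of b x] cov[of b y] pos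
        by (auto simp: colon_graph_def)
      moreover have "x \<in> C \<or> y \<in> C" using cov xy by blast
      ultimately show "2 \<le> cdeg C (single x 1 + single y 1 + n)" unfolding deg by auto
    qed
  next
    assume n: "single x 1 + single y 1 + n \<in> symbolic_exponents E"
    show "n \<in> edge_exponents (colon_graph E {} x y)"
    proof (rule ccontr)
      assume "\<not> ?thesis"
      then have T: "\<not> colon_graph E {} x y a b" if "0 < lookup n a" "0 < lookup n b" for a b
        using that unfolding edge_exponents_def by blast
      have contra: False if z: "z = x \<or> z = y" and nz: "\<And>a. 0 < lookup n a \<Longrightarrow> \<not> adj E a z" for z
      proof -
        let ?C = "- insert z {a. 0 < lookup n a}"
        have "vertex_cover E ?C"
        proof (rule vertex_cover_Compl)
          fix a b assume "a \<in> insert z {a. 0 < lookup n a}" "b \<in> insert z {a. 0 < lookup n a}"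
          then show "\<not> adj E a b"
            using nz T[of a b] adj_irrefl[OF E] adj_commute[of a b E] by (auto simp: colon_graph_def)
        qed
        then have "2 \<le> cdeg ?C (single x 1 + single y 1 + n)" using n by (auto simp: symbolic_exponents_def)
        moreover have "cdeg ?C n = 0" by (simp add: cdeg_def)
        ultimately show False using z unfolding deg by (auto simp: of_bool_def split: if_splits)
      qed
      obtain a where "0 < lookup n a" "adj E a x" using contra[of x] by blast
      moreover obtain b where "0 < lookup n b" "adj E b y" using contra[of y] by blast
      ultimately show False using T[of a b] by (auto simp: colon_graph_def)
    qed
  }
qed

lemma edge_added_colon:
  fixes E :: "'v::finite set set"
  assumes E: "simple_graph E" and xy: "adj E x y" and F: "F \<subseteq> E" "\<not> adj F x y"
  shows "{n. single x 1 + single y 1 + n \<in> edge_added E F} = edge_exponents (colon_graph E F x y)"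
proof -
  have pos: "0 < lookup (single x 1 + single y 1 + n) a \<longleftrightarrow> a = x \<or> a = y \<or> 0 < lookup n a"
    for n :: "'v \<Rightarrow>\<^sub>0 nat" and a
    by (simp only: add.assoc lookup_single_add_pos)
  have "single x 1 + single y 1 + n \<in> edge_exponents (adj F) \<longleftrightarrow>
     (\<exists>a b. adj F a b \<and> (a = x \<or> a = y \<or> 0 < lookup n a) \<and> (b = x \<or> b = y \<or> 0 < lookup n b))" for n
    by (simp add: edge_exponents_def pos del: One_nat_def)
  moreover have "\<not> adj F a a" for a using adj_irrefl[OF E] F(1) by blast
  moreover have "adj F a b \<longleftrightarrow> adj F b a" for a b by (rule adj_commute)
  \<comment> \<open>An edge of F inside \<open>{x, y}\<close> is impossible, so at least one end is
    found in the support of n.\<close>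
  ultimately have ex: "single x 1 + single y 1 + n \<in> edge_exponents (adj F) \<longleftrightarrow>
     (\<exists>a b. adj F a b \<and> 0 < lookup n a \<and> 0 < lookup n b)
     \<or> (\<exists>a. 0 < lookup n a \<and> (adj F a x \<or> adj F a y))" for n
    using F(2) by blast
  have FE: "adj E a b" if "adj F a b" for a b using that F(1) by blast
  have ex3: "n \<in> edge_exponents (colon_graph E F x y) \<longleftrightarrow> n \<in> edge_exponents (colon_graph E {} x y)
     \<or> (\<exists>a. 0 < lookup n a \<and> (adj F a x \<or> adj F a y))" for n
    unfolding edge_exponents_def colon_graph_def by auto
  have ex4: "n \<in> edge_exponents (colon_graph E {} x y)"
    if "adj E a b" "0 < lookup n a" "0 < lookup n b" for n a b
    using that unfolding edge_exponents_def colon_graph_def by blast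
  have "single x 1 + single y 1 + n \<in> edge_added E F \<longleftrightarrow> n \<in> edge_exponents (colon_graph E F x y)" for n
    unfolding edge_added_def Un_iff symbolic_exponents_colon[OF E xy] ex
    using ex3[of n] ex4[of _ _ n] FE by blast
  then show ?thesis by blast
qed

lemma edge_added_insert:
  assumes "x \<noteq> y"
  shows "edge_added E (insert {x, y} F) = edge_added E F \<union> range ((+) (single x 1 + single y 1))"
proof -
  have "n \<in> range ((+) (single x 1 + single y 1)) \<longleftrightarrow> 0 < lookup n x \<and> 0 < lookup n y"
    for n :: "'a \<Rightarrow>\<^sub>0 nat"
  proof -
    have "lookup (single x 1 + single y 1) v = (of_bool (v = x \<or> v = y) :: nat)" for v
      using assms by (auto simp: lookup_add lookup_single when_def)
    then have "n \<in> range ((+) (single x 1 + single y 1)) \<longleftrightarrow> (\<forall>v. of_bool (v = x \<or> v = y) \<le> lookup n v)"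
      unfolding range_plus by (simp only: mem_Collect_eq)
    then show ?thesis by (auto simp: Suc_le_eq)
  qed
  then show ?thesis
    by (auto simp: edge_added_def edge_exponents_def doubleton_eq_iff)
qed

text \<open>The second symbolic power lies in the edge ideal: a monomial with independent support
  has degree 0 on the complementary cover.\<close>

lemma edge_added_all:
  fixes E :: "'v::finite set set"
  shows "edge_added E E = edge_exponents (adj E)"
proof -
  have "n \<in> edge_exponents (adj E)" if n: "n \<in> symbolic_exponents E" for n
  proof (rule ccontr)
    assume "n \<notin> edge_exponents (adj E)"
    then have "\<not> adj E a b" if "a \<in> {a. 0 < lookup n a}" "b \<in> {a. 0 < lookup n a}" for a b
      using that unfolding edge_exponents_def by blast
    then have "vertex_cover E (- {a. 0 < lookup n a})" by (rule vertex_cover_Compl)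
    then have "2 \<le> cdeg (- {a. 0 < lookup n a}) n" using n by (auto simp: symbolic_exponents_def)
    then show False by (simp add: cdeg_def)
  qed
  then show ?thesis by (auto simp: edge_added_def)
qed

lemma upset_edge_added: "upset (edge_added E F)"
  using upset_symbolic_exponents[of E] upset_edge_exponents[of "adj F"]
  by (auto simp: upset_def edge_added_def)

lemma foldl_extend_subset:
  assumes "is_ideal K" "J \<subseteq> K" "set gs \<subseteq> K" shows "foldl extend J gs \<subseteq> K"
  using assms(2,3)
proof (induction gs arbitrary: J)
  case (Cons g gs)
  have "extend J g \<subseteq> K"
    using Cons.prems by (auto elim!: extendE intro!: is_ideal_add[OF assms(1)] is_ideal_mult_right[OF assms(1)])
  then show ?case using Cons by simp
qed simp

lemma lin_in_graded_max_ideal: "lin c \<in> (graded_max_ideal :: ('v::finite, 'k::field) mpoly set)"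
proof -
  interpret cring "mpoly_ring :: ('v, 'k) mpoly ring" by (rule cring_from_type_algebra)
  have "ideal (graded_max_ideal :: ('v, 'k) mpoly set) mpoly_ring"
    unfolding graded_max_ideal_def by (rule genideal_ideal) simp
  then have m: "is_ideal (graded_max_ideal :: ('v, 'k) mpoly set)" by (simp add: ideal_iff_is_ideal)
  have "Var v \<in> (graded_max_ideal :: ('v, 'k) mpoly set)" for v
    unfolding graded_max_ideal_def
    using genideal_self[of "Var ` UNIV :: ('v, 'k) mpoly set"] by auto
  then have "Var v * single 0 (c v) \<in> graded_max_ideal" for v by (rule is_ideal_mult_right[OF m])
  then have "(\<Sum>v\<in>UNIV. Var v * single 0 (c v)) \<in> graded_max_ideal" by (intro is_ideal_sum[OF m])
  then show ?thesis by (simp add: lin_def Var_mult_single)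
qed

section \<open>The regular sequence of a star packing\<close>

locale packed_stars =
  fixes E :: "'v::finite set set" and r :: nat and z :: "nat \<Rightarrow> 'v"
  assumes simple: "simple_graph E"
    and disjoint: "\<And>i k. i \<le> r \<Longrightarrow> k \<le> r \<Longrightarrow> i \<noteq> k \<Longrightarrow> closed_nbhd E (z i) \<inter> closed_nbhd E (z k) = {}"
begin

abbreviation A :: "nat \<Rightarrow> 'v set" where "A i \<equiv> closed_nbhd E (z i)"

lemma adj_star: "adj E (z i) x \<Longrightarrow> x \<in> A i"
  by (simp add: closed_nbhd_def nbhd_def)

lemma adj_unique: "i \<le> r \<Longrightarrow> k \<le> r \<Longrightarrow> adj E (z i) x \<Longrightarrow> adj E (z k) x \<Longrightarrow> i = k"
  using disjoint[of i k] adj_star by blast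

lemma wreg_adj: "wreg (mideal (edge_exponents (adj E)) :: ('v, 'k::field) mpoly set) (star_seq A r)"
proof (rule wreg_edge_exponents[OF disjoint])
  show "symp (adj E)" by (rule sympI) (simp add: insert_commute)
  show "\<exists>c. centre (adj E) (A i) c" for i
    using adj_irrefl[OF simple] adj_star by (auto simp: centre_def closed_nbhd_def intro!: exI[of _ "z i"])
qed

text \<open>A vertex z_i adjacent to neither x nor y gets no new neighbour and no loop, so it
  remains a centre. What matters is how many indices are exceptional.\<close>

lemma wreg_colon_graph:
  assumes xy: "adj E x y" and F: "F \<subseteq> E" "\<not> adj F x y"
  shows "wreg (mideal (edge_exponents (colon_graph E F x y)) :: ('v, 'k::field) mpoly set) (star_seq A r)"
proof -
  let ?h = "colon_graph E F x y"
  note irr = adj_irrefl[OF simple]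
  have FE: "adj E a b" if "adj F a b" for a b using that F(1) by blast
  have sym: "symp ?h"
    by (rule sympI) (auto simp: colon_graph_def insert_commute)
  have cen: "\<exists>c. centre ?h (A i) c" if "\<not> adj E (z i) x" "\<not> adj E (z i) y" for i
  proof
    show "centre ?h (A i) (z i)"
      using that irr FE adj_star by (auto simp: centre_def colon_graph_def closed_nbhd_def nbhd_def)
  qed
  show ?thesis
  proof (cases "\<exists>j. \<forall>i\<le>r. i \<noteq> j \<longrightarrow> \<not> adj E (z i) x \<and> \<not> adj E (z i) y")
    case True
    then obtain j where j: "\<And>i. i \<le> r \<Longrightarrow> i \<noteq> j \<Longrightarrow> \<not> adj E (z i) x \<and> \<not> adj E (z i) y" by blast
    show ?thesis
    proof (rule wreg_edge_exponents[OF disjoint sym])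
      show "\<exists>c. centre ?h (A i) c" if "i \<le> r" "i \<noteq> j" for i using cen j[OF that] by blast
    qed
  next
    case False
    \<comment> \<open>Disjointness makes x, and likewise y, adjacent to at most one z_i. As no
      single index accounts for all exceptions, there are exactly two.\<close>
    obtain p where p: "p \<le> r" "adj E (z p) x" using False adj_unique by metis
    obtain q where q: "q \<le> r" "adj E (z q) y" using False adj_unique by metis
    have "p \<noteq> q" using False p q adj_unique by metis
    show ?thesis
    proof (rule wreg_edge_exponents_joined[OF disjoint p(1) q(1) \<open>p \<noteq> q\<close> adj_star[OF p(2)] adj_star[OF q(2)] sym])
      have nF: "\<not> adj F x x" "\<not> adj F y y" by (rule contrapos_nn[OF irr], erule FE)+
      moreover have "\<not> adj F y x" using F(2) by (subst adj_commute)
      ultimately have loops: "\<not> ?h x x" "\<not> ?h y y" using irr F(2) by (auto simp: colon_graph_def)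
      then show "\<not> ?h x x" "\<not> ?h y y" by blast+
      \<comment> \<open>The joining gives x and y no new neighbours, so the complete join still
        refers to the full neighbourhoods in the new graph.\<close>
      have adj_x: "adj E a x" if "?h a x" for a
        using that irr[of x] loops(1) by (cases "a = x") (auto simp: colon_graph_def)
      have adj_y: "adj E b y" if "?h b y" for b
        using that irr[of y] loops(2) by (cases "b = y") (auto simp: colon_graph_def)
      show "?h a b" if "?h a x" "?h b y" for a b
        using adj_x[OF that(1)] adj_y[OF that(2)] by (simp add: colon_graph_def)
      show "\<exists>c. centre ?h (A i) c" if "i \<le> r" "i \<noteq> p" "i \<noteq> q" for i
        using that p q adj_unique by (intro cen) blast+
    qed
  qed
qed

lemma wreg_edge_added:
  "F \<subseteq> E \<Longrightarrow> wreg (mideal (edge_added E F) :: ('v, 'k::field) mpoly set) (star_seq A r)"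
proof (induction "card (E - F)" arbitrary: F rule: less_induct)
  case less
  show ?case
  proof (cases "F = E")
    case True then show ?thesis by (simp add: edge_added_all wreg_adj)
  next
    case False
    then obtain e where e: "e \<in> E" "e \<notin> F" using less.prems by blast
    then obtain x y where xy: "e = {x, y}" "x \<noteq> y" using simple by (auto simp: simple_graph_def card_2_iff)
    show ?thesis
    proof (rule wreg_mideal_filtration[OF upset_edge_added, of "single x 1 + single y 1"])
      show "wreg (mideal {n. single x 1 + single y 1 + n \<in> edge_added E F} :: ('v, 'k) mpoly set) (star_seq A r)"
        using e xy less.prems by (subst edge_added_colon[OF simple]) (auto intro: wreg_colon_graph)
      have "card (E - insert e F) < card (E - F)" using e by (intro psubset_card_mono) auto
      then have "wreg (mideal (edge_added E (insert e F)) :: ('v, 'k) mpoly set) (star_seq A r)"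
        using e less.prems by (intro less.hyps) auto
      then show "wreg (mideal (edge_added E F \<union> range ((+) (single x 1 + single y 1))) :: ('v, 'k) mpoly set)
          (star_seq A r)"
        unfolding xy(1) edge_added_insert[OF xy(2)] .
    qed
  qed
qed

lemma wreg_symbolic_square:
  "wreg (symbolic_power mpoly_ring (edge_ideal E :: ('v, 'k::field) mpoly set) 2) (star_seq A r)"
  using wreg_edge_added[of "{}"]
  by (simp add: symbolic_square[OF simple] edge_added_def edge_exponents_def)

lemma depth_symbolic_square:
  "enat r \<le> depth (mpoly_ring :: ('v, 'k::field) mpoly ring) graded_max_ideal
     (quot_module mpoly_ring (symbolic_power mpoly_ring (edge_ideal E) 2))"
proof -
  let ?J = "symbolic_power mpoly_ring (edge_ideal E :: ('v, 'k) mpoly set) 2"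
  let ?gs = "star_seq A r :: ('v, 'k) mpoly list"
  let ?m = "cover_prime UNIV :: ('v, 'k) mpoly set"
  have J: "?J = mideal (symbolic_exponents E)" by (rule symbolic_square[OF simple])
  have m: "is_ideal ?m" by (rule is_ideal_cover_prime)
  \<comment> \<open>The set of all vertices is a cover, so no element of the ideal has a constant
    term; this yields properness.\<close>
  have "2 \<le> cdeg UNIV n" if "n \<in> symbolic_exponents E" for n
    using that by (auto simp: symbolic_exponents_def vertex_cover_def)
  then have "?J \<subseteq> ?m" unfolding J cover_prime_def mideal_def by fastforce
  moreover have "set ?gs \<subseteq> ?m" by (auto simp: star_seq_def lin_in_cover_prime)
  ultimately have "foldl extend ?J ?gs \<subseteq> ?m" by (rule foldl_extend_subset[OF m])
  moreover have "1 \<notin> ?m" by (simp add: cover_prime_def mideal_def cdeg_def)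
  ultimately have "1 \<notin> foldl extend ?J ?gs" by blast
  then have "regular_sequence mpoly_ring (quot_module mpoly_ring ?J) ?gs"
    by (intro regular_sequence_quot_module wreg_symbolic_square)
       (simp_all add: J is_ideal_mideal upset_symbolic_exponents)
  moreover have "set ?gs \<subseteq> graded_max_ideal"
    by (auto simp: star_seq_def lin_in_graded_max_ideal)
  moreover have "length ?gs = r" by (simp add: star_seq_def)
  ultimately have "enat r \<in> {enat (length fs) | fs.
      regular_sequence mpoly_ring (quot_module mpoly_ring ?J) fs \<and> set fs \<subseteq> graded_max_ideal}"
    by (intro CollectI exI[of _ ?gs]) simp
  then show ?thesis unfolding depth_def by (rule Sup_upper)
qed

end

theorem theorem4p2:
  fixes E :: "'v::finite set set"
  assumes "simple_graph E"
  shows "depth (mpoly_ring :: ('v, 'k::field) mpoly ring) graded_max_ideal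
           (quot_module mpoly_ring (symbolic_power mpoly_ring (edge_ideal E) 2))
         \<ge> enat (star_packing_number E) - 1"
proof -
  let ?S = "{P. star_packing E P}"
  have "finite ?S" by (rule finite_subset[of _ "Pow (star E ` UNIV)"]) (auto simp: star_packing_def)
  moreover have "{} \<in> ?S" by (simp add: star_packing_def)
  ultimately have "star_packing_number E \<in> card ` ?S"
    unfolding star_packing_number_def by (intro Max_in) auto
  then obtain P where P: "star_packing E P" "card P = star_packing_number E" by auto
  show ?thesis
  proof (cases "star_packing_number E")
    \<comment> \<open>Subtraction on \<open>enat\<close> is truncated, so the bound is 0
      here.\<close>
    case 0 then show ?thesis by (simp add: one_enat_def flip: zero_enat_def)
  next
    case (Suc r)
    \<comment> \<open>The r + 1 stars are indexed from 0 to r. The last one is the reference star of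
      the differences, which leaves r elements.\<close>
    then have "finite P" using P(2) card_ge_0_finite[of P] by simp
    then obtain s where s: "bij_betw s {0..<Suc r} P" using ex_bij_betw_nat_finite P(2) Suc by metis
    have "\<exists>x. s i = star E x" if "i \<le> r" for i
    proof -
      have "s i \<in> P" using s that by (auto simp: bij_betw_def)
      then show ?thesis using P(1) by (auto simp: star_packing_def)
    qed
    then obtain z where z: "\<And>i. i \<le> r \<Longrightarrow> s i = star E (z i)" by metis
    interpret packed_stars E r z
    proof
      fix i k assume ik: "i \<le> r" "k \<le> r" "i \<noteq> k"
      then have "s i \<in> P" "s k \<in> P" "s i \<noteq> s k"
        using s by (auto simp: bij_betw_def inj_on_def)
      then have "disjnt (fst (s i)) (fst (s k))" using P(1) by (auto simp: star_packing_def pairwise_def)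
      then show "closed_nbhd E (z i) \<inter> closed_nbhd E (z k) = {}"
        using z ik by (simp add: star_def disjnt_def)
    qed (rule assms)
    show ?thesis using depth_symbolic_square by (simp add: Suc one_enat_def)
  qed
qed

end
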